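(* Suppose that $g>1$. Let $n$ be an integer such that $3\le n\le 2g$. Then $\mathcal{C}(K)$ does not contain a point of order $n$ in $J(K)$. In particular, $\mathcal{C}(K)$ does not contain points of order $3$ or $4$.
   Context: $K$ is an algebraically closed field of characteristic different from $2$, $g\ge 1$ is an integer, $\alpha_1,\dots,\alpha_{2g+1}$ are distinct elements of $K$, and $f(x)=\prod_{i=1}^{2g+1}(x-\alpha_i)$. $\mathcal{C}$ is the smooth projective model of the smooth affine plane $K$-curve $y^2=f(x)$; it is a genus $g$ hyperelliptic curve with exactly one infinite point, denoted $\infty$. $J$ is the jacobian of $\mathcal{C}$, and for a degree zero divisor $D$ on $\mathcal{C}$, $\mathrm{cl}(D)\in J(K)$ is its linear equivalence class. $\mathcal{C}$ is identified with its image in $J$ under the canonical embedding $P\mapsto \mathrm{cl}((P)-(\infty))$, so that $\infty$ is the zero of the group law and $\mathcal{C}(K)\subset J(K)$. *)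

theory Defs
  imports "HOL-Algebra.Algebraic_Closure_Type" "HOL-Algebra.Free_Abelian_Groups"
    "HOL-Algebra.Multiplicative_Group"
begin

definition curve_poly :: "(nat \<Rightarrow> 'a::alg_closed_field) \<Rightarrow> nat \<Rightarrow> 'a poly" where
  "curve_poly \<alpha> g = (\<Prod>i\<in>{1..2*g+1}. [:- \<alpha> i, 1:])"

datatype 'a curve_point = Affine 'a 'a | Infinity

definition curve_points :: "(nat \<Rightarrow> 'a::alg_closed_field) \<Rightarrow> nat \<Rightarrow> 'a curve_point set" where
  "curve_points \<alpha> g = insert Infinity {Affine a b | a b. b ^ 2 = poly (curve_poly \<alpha> g) a}"

text \<open>
  The function field of the curve is realised as the subfield \<open>K(x, y)\<close> of the algebraic closure
  of \<open>K(x)\<close>, where \<open>y\<close> is a square root of \<open>f(x)\<close>. The two choices of \<open>y\<close> differ by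
  the hyperelliptic involution.
\<close>

type_synonym 'a function_over = "'a poly fract alg_closure"

definition poly_fun :: "'a::field poly \<Rightarrow> 'a function_over" where
  "poly_fun p = to_ac (to_fract p)"

definition const_fun :: "'a::field \<Rightarrow> 'a function_over" where
  "const_fun c = poly_fun [:c:]"

definition x_fun :: "'a::field function_over" where
  "x_fun = poly_fun [:0, 1:]"

definition y_fun :: "(nat \<Rightarrow> 'a::alg_closed_field) \<Rightarrow> nat \<Rightarrow> 'a function_over" where
  "y_fun \<alpha> g = (SOME y. y ^ 2 = poly_fun (curve_poly \<alpha> g))"

text \<open>
  An element \<open>r\<close> of type \<open>'a poly poly\<close> is a polynomial in two variables; in \<open>eval2 e r (u, v)\<close>
  the inner variable is replaced by \<open>u\<close>, the outer one by \<open>v\<close>, and \<open>e\<close> embeds the coefficients.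
\<close>

definition eval2 :: "('a::zero \<Rightarrow> 'b::comm_semiring_0) \<Rightarrow> 'a poly poly \<Rightarrow> 'b \<times> 'b \<Rightarrow> 'b" where
  "eval2 e r = (\<lambda>(u, v). poly (map_poly (\<lambda>c. poly (map_poly e c) u) r) v)"

definition function_field :: "(nat \<Rightarrow> 'a::alg_closed_field) \<Rightarrow> nat \<Rightarrow> 'a function_over set" where
  "function_field \<alpha> g =
     {eval2 const_fun r (x_fun, y_fun \<alpha> g) / eval2 const_fun s (x_fun, y_fun \<alpha> g) | r s.
        eval2 const_fun s (x_fun, y_fun \<alpha> g) \<noteq> 0}"

text \<open>
  The smooth projective model is glued from the affine curve \<open>y\<^sup>2 = f(x)\<close> and the smooth affine
  curve \<open>w\<^sup>2 = v\<^bsup>2g+2\<^esup> f(1/v) = v \<Prod>\<^sub>i (1 - \<alpha>\<^sub>i v)\<close> by \<open>v = 1/x\<close> and \<open>w = y/x\<^bsup>g+1\<^esup>\<close>; the only point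
  of the second curve that is not on the first is \<open>(v, w) = (0, 0)\<close>. Every point is thus given by
  a pair of coordinate functions and the pair of their values at the point.
\<close>

fun coord_funs ::
  "(nat \<Rightarrow> 'a::alg_closed_field) \<Rightarrow> nat \<Rightarrow> 'a curve_point \<Rightarrow> 'a function_over \<times> 'a function_over"
where
  "coord_funs \<alpha> g (Affine a b) = (x_fun, y_fun \<alpha> g)"
| "coord_funs \<alpha> g Infinity = (1 / x_fun, y_fun \<alpha> g / x_fun ^ (g + 1))"

fun coord_values :: "'a::zero curve_point \<Rightarrow> 'a \<times> 'a" where
  "coord_values (Affine a b) = (a, b)"
| "coord_values Infinity = (0, 0)"

definition local_ring ::
  "(nat \<Rightarrow> 'a::alg_closed_field) \<Rightarrow> nat \<Rightarrow> 'a curve_point \<Rightarrow> 'a function_over set" where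
  "local_ring \<alpha> g P =
     {eval2 const_fun r (coord_funs \<alpha> g P) / eval2 const_fun s (coord_funs \<alpha> g P) | r s.
        eval2 id s (coord_values P) \<noteq> 0}"

definition max_ideal ::
  "(nat \<Rightarrow> 'a::alg_closed_field) \<Rightarrow> nat \<Rightarrow> 'a curve_point \<Rightarrow> 'a function_over set" where
  "max_ideal \<alpha> g P =
     {eval2 const_fun r (coord_funs \<alpha> g P) / eval2 const_fun s (coord_funs \<alpha> g P) | r s.
        eval2 id r (coord_values P) = 0 \<and> eval2 id s (coord_values P) \<noteq> 0}"

definition uniformizer ::
  "(nat \<Rightarrow> 'a::alg_closed_field) \<Rightarrow> nat \<Rightarrow> 'a curve_point \<Rightarrow> 'a function_over \<Rightarrow> bool" where
  "uniformizer \<alpha> g P t \<longleftrightarrow> max_ideal \<alpha> g P = {t * u | u. u \<in> local_ring \<alpha> g P}"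

text \<open>
  The order of vanishing of a nonzero function \<open>h\<close> at \<open>P\<close>: write \<open>h = t\<^bsup>k\<^esup> u\<close> with a uniformizer
  \<open>t\<close> and a unit \<open>u\<close> of the local ring. It is unspecified for \<open>h = 0\<close>.
\<close>

definition order_at ::
  "(nat \<Rightarrow> 'a::alg_closed_field) \<Rightarrow> nat \<Rightarrow> 'a curve_point \<Rightarrow> 'a function_over \<Rightarrow> int" where
  "order_at \<alpha> g P h =
     (THE k. \<exists>t u. uniformizer \<alpha> g P t \<and> u \<in> local_ring \<alpha> g P - max_ideal \<alpha> g P \<and>
        h = t powi k * u)"

type_synonym 'a divisor = "'a curve_point \<Rightarrow>\<^sub>0 int"

definition divisor_degree :: "'a divisor \<Rightarrow> int" where
  "divisor_degree D = (\<Sum>P\<in>Poly_Mapping.keys D. Poly_Mapping.lookup D P)"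

definition degree_zero_divisors :: "(nat \<Rightarrow> 'a::alg_closed_field) \<Rightarrow> nat \<Rightarrow> 'a divisor monoid" where
  "degree_zero_divisors \<alpha> g =
     (free_Abelian_group (curve_points \<alpha> g))
       \<lparr>carrier := {D \<in> carrier (free_Abelian_group (curve_points \<alpha> g)). divisor_degree D = 0}\<rparr>"

text \<open>
  Divisors of functions have finite support and degree zero, so restricting to
  \<^const>\<open>degree_zero_divisors\<close> here excludes no divisor of a function.
\<close>

definition principal_divisors :: "(nat \<Rightarrow> 'a::alg_closed_field) \<Rightarrow> nat \<Rightarrow> 'a divisor set" where
  "principal_divisors \<alpha> g =
     {D \<in> carrier (degree_zero_divisors \<alpha> g).
        \<exists>h\<in>function_field \<alpha> g - {0}. \<forall>P\<in>curve_points \<alpha> g.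
          Poly_Mapping.lookup D P = order_at \<alpha> g P h}"

text \<open>
  Since the ground field is algebraically closed, the group of its points on the jacobian is the
  group of degree zero divisors modulo linear equivalence.
\<close>

definition jacobian :: "(nat \<Rightarrow> 'a::alg_closed_field) \<Rightarrow> nat \<Rightarrow> 'a divisor set monoid" where
  "jacobian \<alpha> g = degree_zero_divisors \<alpha> g Mod principal_divisors \<alpha> g"

definition divisor_class ::
  "(nat \<Rightarrow> 'a::alg_closed_field) \<Rightarrow> nat \<Rightarrow> 'a divisor \<Rightarrow> 'a divisor set" where
  "divisor_class \<alpha> g D = principal_divisors \<alpha> g #>\<^bsub>degree_zero_divisors \<alpha> g\<^esub> D"

definition canonical_embedding ::
  "(nat \<Rightarrow> 'a::alg_closed_field) \<Rightarrow> nat \<Rightarrow> 'a curve_point \<Rightarrow> 'a divisor set" where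
  "canonical_embedding \<alpha> g P = divisor_class \<alpha> g (frag_of P - frag_of Infinity)"

definition embedded_curve :: "(nat \<Rightarrow> 'a::alg_closed_field) \<Rightarrow> nat \<Rightarrow> 'a divisor set set" where
  "embedded_curve \<alpha> g = canonical_embedding \<alpha> g ` curve_points \<alpha> g"

end

theory Submission
  imports Defs
begin

text \<open>
  Let \<open>P = (a, b)\<close> be an affine point whose class has order \<open>n\<close> with \<open>3 \<le> n \<le> 2g\<close>, and let
  \<open>h\<close> be a function with divisor \<open>n (P - \<infinity>)\<close>. Then \<open>h\<close> has no poles on the affine curve, so it
  is of the form \<open>p(x) + q(x) y\<close> with polynomials \<open>p\<close> and \<open>q\<close> (\<open>regular_imp_polynomial\<close>).
  At infinity \<open>x\<close> has a pole of order \<open>2\<close> and \<open>y\<close> one of order \<open>2g + 1\<close>; the two summands have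
  pole orders of different parity, so \<open>q \<noteq> 0\<close> would force a pole of order at least \<open>2g + 1 > n\<close>
  (\<open>is_order_infinity_sum\<close>). Hence \<open>h = p(x)\<close> is invariant under the hyperelliptic involution
  \<open>(a, b) \<mapsto> (a, - b)\<close>, and so is its only zero: \<open>b = 0\<close>
  (\<open>small_pole_imp_Weierstrass\<close>). But then \<open>x - a\<close> has divisor \<open>2 (P - \<infinity>)\<close>, so the order of the
  class divides \<open>2\<close>, a contradiction. The point \<open>\<infinity>\<close> itself has order \<open>1\<close>.

  To make sense of this, orders of vanishing have to be defined, additive, and available for
  every nonzero function at every point; only then do the principal divisors form a subgroup and is
  the jacobian a group. The local theory rests on three observations. First, a local ring with a principal
  maximal ideal has a well-defined additive order, for purely formal reasons (\<open>specialization\<close>,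
  \<open>valuation\<close>). Second, the affine curve and its chart at infinity are both of the form
  \<open>y\<^sup>2 = F(x)\<close>, and at a smooth point the maximal ideal is generated by \<open>x - a\<close> if \<open>b \<noteq> 0\<close> and by
  \<open>y\<close> if \<open>b = 0\<close> (\<open>chart_point\<close>). Third, a nonzero function \<open>p(x) + q(x) y\<close> has an order because it
  divides its norm \<open>p\<^sup>2 - q\<^sup>2 F\<close>, a nonzero polynomial in \<open>x\<close>, whose order is known. At
  infinity, where \<open>x\<close> and \<open>y\<close> are not regular, the parity argument above gives the order directly.
\<close>

section \<open>Evaluation homomorphisms\<close>

locale unital_hom =
  fixes e :: "'a::comm_ring_1 \<Rightarrow> 'b::comm_ring_1"
  assumes hom_add: "e (u + v) = e u + e v"
    and hom_mult: "e (u * v) = e u * e v"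
    and hom_one: "e 1 = 1"
begin

lemma hom_zero: "e 0 = 0"
  using hom_add[of 0 0] by simp

lemma hom_uminus: "e (- u) = - e u"
  using hom_add[of u "- u"] by (simp add: hom_zero add_eq_0_iff)

lemma hom_diff: "e (u - v) = e u - e v"
  using hom_add[of u "- v"] by (simp add: hom_uminus)

lemma hom_power: "e (u ^ n) = e u ^ n"
  by (induction n) (simp_all add: hom_one hom_mult)

lemma hom_prod: "e (prod f A) = (\<Prod>i\<in>A. e (f i))"
  by (induction A rule: infinite_finite_induct) (simp_all add: hom_one hom_mult)

lemmas hom_simps = hom_zero hom_one hom_add hom_mult hom_uminus hom_diff hom_power

end

definition poly_eval :: "('a::comm_ring_1 \<Rightarrow> 'b::comm_ring_1) \<Rightarrow> 'b \<Rightarrow> 'a poly \<Rightarrow> 'b" where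
  "poly_eval e u p = poly (map_poly e p) u"

lemma poly_eval_id [simp]: "poly_eval id a p = poly p a" "poly_eval (\<lambda>x. x) a p = poly p a"
  by (simp_all add: poly_eval_def)

lemma poly_eval_0 [simp]: "poly_eval e u 0 = 0"
  by (simp add: poly_eval_def)

lemma eval2_conv_poly_eval: "eval2 e r (u, v) = poly_eval (poly_eval e u) v r"
  by (simp add: eval2_def poly_eval_def[abs_def])

context unital_hom
begin

lemma poly_eval_pCons: "poly_eval e u (pCons a p) = e a + u * poly_eval e u p"
  by (simp add: poly_eval_def map_poly_pCons hom_zero)

lemma poly_eval_const: "poly_eval e u [:a:] = e a"
  by (simp add: poly_eval_pCons)

lemma poly_eval_linear: "poly_eval e u [:a, b:] = e a + u * e b"
  by (simp add: poly_eval_pCons)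

lemma poly_eval_add: "poly_eval e u (p + q) = poly_eval e u p + poly_eval e u q"
proof (induction p arbitrary: q)
  case (pCons a p)
  show ?case
  proof (cases q)
    case (pCons b q')
    thus ?thesis using pCons.IH[of q'] by (simp add: poly_eval_pCons hom_add algebra_simps)
  qed
qed simp

lemma poly_eval_smult: "poly_eval e u (smult c p) = e c * poly_eval e u p"
  by (induction p) (simp_all add: poly_eval_pCons hom_mult algebra_simps)

lemma poly_eval_mult: "poly_eval e u (p * q) = poly_eval e u p * poly_eval e u q"
  by (induction p)
    (simp_all add: poly_eval_pCons hom_zero poly_eval_add poly_eval_smult algebra_simps)

lemma unital_hom_poly_eval: "unital_hom (poly_eval e u)"
  by unfold_locales
    (simp_all add: poly_eval_add poly_eval_mult poly_eval_const hom_one one_pCons)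

lemma unital_hom_eval2: "unital_hom (\<lambda>r. eval2 e r (u, v))"
  unfolding eval2_conv_poly_eval
  by (intro unital_hom.unital_hom_poly_eval unital_hom_poly_eval)

lemma eval2_const: "eval2 e [:p:] (u, v) = poly_eval e u p"
  unfolding eval2_conv_poly_eval by (rule unital_hom.poly_eval_const[OF unital_hom_poly_eval])

lemma eval2_linear: "eval2 e [:p, q:] (u, v) = poly_eval e u p + poly_eval e u q * v"
  unfolding eval2_conv_poly_eval
  by (simp add: unital_hom.poly_eval_linear[OF unital_hom_poly_eval])

end

lemma unital_hom_id: "unital_hom id"
  by unfold_locales simp_all

text \<open>
  Division by the monic polynomial \<open>y\<^sup>2 - F(x)\<close> leaves a remainder linear in \<open>y\<close>: on the curve
  \<open>y\<^sup>2 = F(x)\<close> every polynomial function has the form \<open>p(x) + q(x) y\<close>.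
\<close>

lemma linear_remainder:
  fixes F :: "'a::comm_ring_1 poly"
  shows "\<exists>c p q. r = c * [:- F, 0, 1:] + [:p, q:]"
proof (induction r)
  case 0
  show ?case by (rule exI[of _ 0], rule exI[of _ 0], rule exI[of _ 0]) simp
next
  case (pCons a r)
  then obtain c p q where r: "r = c * [:- F, 0, 1:] + [:p, q:]" by blast
  have "pCons a r = (pCons q c) * [:- F, 0, 1:] + [:a + q * F, p:]"
    unfolding r by (simp add: mult_pCons_left smult_add_right algebra_simps)
  thus ?case by blast
qed

section \<open>The local ring of a specialization\<close>

text \<open>
  A function field element is a fraction \<open>\<phi> r / \<phi> s\<close> of formal expressions, and \<open>\<psi>\<close> evaluates
  expressions at a point. If relations between functions persist at the point, that is if
  \<open>ker \<phi> \<subseteq> ker \<psi>\<close>, the fractions whose denominator does not vanish there form a local ring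
  \<open>R\<close> with maximal ideal \<open>M\<close>. Nothing else about curves enters the theory of orders of
  vanishing below. The four definitions have the same form as those of the local ring, the maximal
  ideal, the uniformizers and the order at a point of the curve.
\<close>

locale specialization = \<phi>: unital_hom \<phi> + \<psi>: unital_hom \<psi>
  for \<phi> :: "'r::comm_ring_1 \<Rightarrow> 'l::field" and \<psi> :: "'r \<Rightarrow> 'k::field" +
  assumes kernel: "\<phi> r = 0 \<Longrightarrow> \<psi> r = 0"
begin

definition R :: "'l set" where
  "R = {\<phi> r / \<phi> s | r s. \<psi> s \<noteq> 0}"

definition M :: "'l set" where
  "M = {\<phi> r / \<phi> s | r s. \<psi> r = 0 \<and> \<psi> s \<noteq> 0}"

definition generates :: "'l \<Rightarrow> bool" where
  "generates t \<longleftrightarrow> M = {t * u | u. u \<in> R}"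

definition has_order :: "'l \<Rightarrow> int \<Rightarrow> bool" where
  "has_order h k \<longleftrightarrow> (\<exists>t u. generates t \<and> u \<in> R - M \<and> h = t powi k * u)"

lemma RI: "\<psi> s \<noteq> 0 \<Longrightarrow> \<phi> r / \<phi> s \<in> R"
  unfolding R_def by blast

lemma RE:
  assumes "h \<in> R"
  obtains r s where "h = \<phi> r / \<phi> s" "\<psi> s \<noteq> 0" "\<phi> s \<noteq> 0"
  using assms kernel unfolding R_def by blast

lemma ME:
  assumes "h \<in> M"
  obtains r s where "h = \<phi> r / \<phi> s" "\<psi> r = 0" "\<psi> s \<noteq> 0" "\<phi> s \<noteq> 0"
  using assms kernel unfolding M_def by blast

text \<open>
  Membership in \<open>M\<close> does not depend on the chosen fraction; this is where the inclusion of kernels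
  is used. It shows in particular that \<open>R - M\<close> consists of units.
\<close>

lemma fraction_mem_M_iff:
  assumes "\<psi> s \<noteq> 0"
  shows "\<phi> r / \<phi> s \<in> M \<longleftrightarrow> \<psi> r = 0"
proof
  assume "\<phi> r / \<phi> s \<in> M"
  then obtain r' s' where *: "\<phi> r / \<phi> s = \<phi> r' / \<phi> s'" "\<psi> r' = 0" "\<psi> s' \<noteq> 0" "\<phi> s' \<noteq> 0"
    by (rule ME)
  have "\<phi> s \<noteq> 0" using assms kernel by blast
  with * have "\<phi> (r * s' - r' * s) = 0"
    by (simp add: \<phi>.hom_simps field_simps)
  hence "\<psi> (r * s' - r' * s) = 0" by (rule kernel)
  with * show "\<psi> r = 0" by (simp add: \<psi>.hom_simps)
next
  assume "\<psi> r = 0"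
  thus "\<phi> r / \<phi> s \<in> M" using assms unfolding M_def by blast
qed

lemma image_mem_R: "\<phi> r \<in> R"
  using RI[of 1 r] by (simp add: \<phi>.hom_one \<psi>.hom_one)

lemma image_mem_M_iff: "\<phi> r \<in> M \<longleftrightarrow> \<psi> r = 0"
  using fraction_mem_M_iff[of 1 r] by (simp add: \<phi>.hom_one \<psi>.hom_one)

lemma M_subset_R: "M \<subseteq> R"
  unfolding R_def M_def by blast

lemma one_mem_R: "1 \<in> R" and zero_mem_M: "0 \<in> M" and one_not_mem_M: "1 \<notin> M"
  using image_mem_R[of 1] image_mem_M_iff[of 0] image_mem_M_iff[of 1]
  by (simp_all add: \<phi>.hom_simps \<psi>.hom_simps)

lemma R_add: assumes "u \<in> R" "v \<in> R" shows "u + v \<in> R"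
proof -
  obtain r s where u: "u = \<phi> r / \<phi> s" "\<psi> s \<noteq> 0" "\<phi> s \<noteq> 0" using assms(1) by (rule RE)
  obtain r' s' where v: "v = \<phi> r' / \<phi> s'" "\<psi> s' \<noteq> 0" "\<phi> s' \<noteq> 0" using assms(2) by (rule RE)
  have "u + v = \<phi> (r * s' + r' * s) / \<phi> (s * s')"
    using u v by (simp add: \<phi>.hom_simps field_simps)
  thus ?thesis using RI[of "s * s'"] u v by (simp add: \<psi>.hom_simps)
qed

lemma R_mult: assumes "u \<in> R" "v \<in> R" shows "u * v \<in> R"
proof -
  obtain r s where u: "u = \<phi> r / \<phi> s" "\<psi> s \<noteq> 0" "\<phi> s \<noteq> 0" using assms(1) by (rule RE)
  obtain r' s' where v: "v = \<phi> r' / \<phi> s'" "\<psi> s' \<noteq> 0" "\<phi> s' \<noteq> 0" using assms(2) by (rule RE)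
  have "u * v = \<phi> (r * r') / \<phi> (s * s')"
    using u v by (simp add: \<phi>.hom_simps)
  thus ?thesis using RI[of "s * s'"] u v by (simp add: \<psi>.hom_simps)
qed

lemma R_uminus: "u \<in> R \<Longrightarrow> - u \<in> R"
  using R_mult[OF image_mem_R[of "- 1"], of u] by (simp add: \<phi>.hom_simps)

lemma R_diff: "u \<in> R \<Longrightarrow> v \<in> R \<Longrightarrow> u - v \<in> R"
  using R_add[of u "- v"] R_uminus[of v] by simp

lemma unit_iff: "u \<in> R - M \<longleftrightarrow> (\<exists>r s. u = \<phi> r / \<phi> s \<and> \<psi> r \<noteq> 0 \<and> \<psi> s \<noteq> 0)"
  by (auto elim!: RE intro: RI simp: fraction_mem_M_iff) (use fraction_mem_M_iff in blast)

lemma unit_nonzero: "u \<in> R - M \<Longrightarrow> u \<noteq> 0"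
  using zero_mem_M by blast

lemma unit_one: "1 \<in> R - M"
  using one_mem_R one_not_mem_M by blast

lemma unit_mult: assumes "u \<in> R - M" "v \<in> R - M" shows "u * v \<in> R - M"
proof -
  obtain r s where u: "u = \<phi> r / \<phi> s" "\<psi> r \<noteq> 0" "\<psi> s \<noteq> 0" using assms(1) unfolding unit_iff by blast
  obtain r' s' where v: "v = \<phi> r' / \<phi> s'" "\<psi> r' \<noteq> 0" "\<psi> s' \<noteq> 0"
    using assms(2) unfolding unit_iff by blast
  have "u * v = \<phi> (r * r') / \<phi> (s * s')" "\<psi> (r * r') \<noteq> 0" "\<psi> (s * s') \<noteq> 0"
    using u v by (simp_all add: \<phi>.hom_simps \<psi>.hom_simps)
  thus ?thesis unfolding unit_iff by blast
qed

lemma unit_inverse: assumes "u \<in> R - M" shows "inverse u \<in> R - M"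
proof -
  obtain r s where "u = \<phi> r / \<phi> s" "\<psi> r \<noteq> 0" "\<psi> s \<noteq> 0" using assms unfolding unit_iff by blast
  hence "inverse u = \<phi> s / \<phi> r" "\<psi> r \<noteq> 0" "\<psi> s \<noteq> 0" by simp_all
  thus ?thesis unfolding unit_iff by blast
qed

lemma unit_power: "u \<in> R - M \<Longrightarrow> u ^ n \<in> R - M"
proof (induction n)
  case 0 thus ?case using unit_one by simp
next
  case (Suc n) thus ?case using unit_mult[of u "u ^ n"] by simp
qed

lemma unit_powi: "u \<in> R - M \<Longrightarrow> u powi k \<in> R - M"
  by (auto simp: power_int_def intro: unit_power[of u, THEN DiffD1] unit_power[of u, THEN DiffD2]
      unit_power[OF unit_inverse, of u, THEN DiffD1] unit_power[OF unit_inverse, of u, THEN DiffD2])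

lemma M_mult: assumes "u \<in> R" "v \<in> M" shows "u * v \<in> M"
proof -
  obtain r s where u: "u = \<phi> r / \<phi> s" "\<psi> s \<noteq> 0" "\<phi> s \<noteq> 0" using assms(1) by (rule RE)
  obtain r' s' where v: "v = \<phi> r' / \<phi> s'" "\<psi> r' = 0" "\<psi> s' \<noteq> 0" "\<phi> s' \<noteq> 0" using assms(2) by (rule ME)
  have "u * v = \<phi> (r * r') / \<phi> (s * s')"
    using u v by (simp add: \<phi>.hom_simps)
  thus ?thesis using fraction_mem_M_iff[of "s * s'"] u v by (simp add: \<psi>.hom_simps)
qed

lemma M_add: assumes "u \<in> M" "v \<in> M" shows "u + v \<in> M"
proof -
  obtain r s where u: "u = \<phi> r / \<phi> s" "\<psi> r = 0" "\<psi> s \<noteq> 0" "\<phi> s \<noteq> 0" using assms(1) by (rule ME)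
  obtain r' s' where v: "v = \<phi> r' / \<phi> s'" "\<psi> r' = 0" "\<psi> s' \<noteq> 0" "\<phi> s' \<noteq> 0" using assms(2) by (rule ME)
  have "u + v = \<phi> (r * s' + r' * s) / \<phi> (s * s')"
    using u v by (simp add: \<phi>.hom_simps field_simps)
  thus ?thesis using fraction_mem_M_iff[of "s * s'"] u v by (simp add: \<psi>.hom_simps)
qed

lemma unit_add_M: assumes "u \<in> R - M" "v \<in> M" shows "u + v \<in> R - M"
proof -
  have "u + v \<notin> M"
  proof
    assume "u + v \<in> M"
    moreover have "- v \<in> M" using M_mult[OF R_uminus[OF one_mem_R] assms(2)] by simp
    ultimately have "u \<in> M" using M_add[of "u + v" "- v"] by simp
    thus False using assms by simp
  qed
  thus ?thesis using R_add[of u v] assms M_subset_R by auto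
qed

lemma generatesI:
  assumes "t \<in> M" and "\<And>r. \<psi> r = 0 \<Longrightarrow> \<exists>u\<in>R. \<phi> r = t * u"
  shows "generates t"
  unfolding generates_def
proof (intro equalityI subsetI)
  fix h assume "h \<in> M"
  then obtain r s where h: "h = \<phi> r / \<phi> s" "\<psi> r = 0" "\<psi> s \<noteq> 0" "\<phi> s \<noteq> 0" by (rule ME)
  obtain u where u: "u \<in> R" "\<phi> r = t * u" using assms(2)[OF h(2)] by blast
  have "h = t * (u * (\<phi> 1 / \<phi> s))" using h u by (simp add: \<phi>.hom_one)
  thus "h \<in> {t * u | u. u \<in> R}" using R_mult[OF u(1) RI[OF h(3)]] by blast
next
  fix h assume "h \<in> {t * u | u. u \<in> R}"
  thus "h \<in> M" using M_mult[OF _ assms(1)] by (auto simp: mult.commute)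
qed

end

text \<open>
  Once the maximal ideal has a nonzero generator \<open>t\<close>, any two generators differ by a unit, so
  that orders can be computed with \<open>t\<close> alone and behave as a discrete valuation. That every
  nonzero function has an order is not implied here, since \<open>R\<close> need not be noetherian.
\<close>

locale valuation = specialization \<phi> \<psi>
  for \<phi> :: "'r::comm_ring_1 \<Rightarrow> 'l::field" and \<psi> :: "'r \<Rightarrow> 'k::field" +
  fixes t :: 'l
  assumes generates: "generates t" and t_nonzero: "t \<noteq> 0"
begin

lemma M_iff: "h \<in> M \<longleftrightarrow> (\<exists>u\<in>R. h = t * u)"
  using generates unfolding generates_def by blast

lemma t_mem_M: "t \<in> M"
  unfolding M_iff using one_mem_R by force

lemma generator_associated:
  assumes "generates t'"
  shows "\<exists>u\<in>R - M. t' = t * u"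
proof -
  have "t' \<in> M"
    using assms one_mem_R unfolding generates_def by force
  then obtain u where u: "u \<in> R" "t' = t * u" unfolding M_iff by blast
  obtain v where v: "v \<in> R" "t = t' * v"
    using t_mem_M assms unfolding generates_def by blast
  have "v * u = 1" using u(2) v(2) t_nonzero by (simp add: mult.assoc mult.commute[of u])
  hence "u \<notin> M" using M_mult[OF v(1), of u] one_not_mem_M by auto
  thus ?thesis using u by blast
qed

lemma has_order_iff: "has_order h k \<longleftrightarrow> (\<exists>u\<in>R - M. h = t powi k * u)"
proof
  assume "has_order h k"
  then obtain t' u where t': "generates t'" and u: "u \<in> R - M" and h: "h = t' powi k * u"
    unfolding has_order_def by blast
  obtain v where v: "v \<in> R - M" "t' = t * v" using generator_associated[OF t'] by blast
  have "h = t powi k * (v powi k * u)" using h v by (simp add: power_int_mult_distrib mult.assoc)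
  moreover have "v powi k * u \<in> R - M" using unit_mult[OF unit_powi[OF v(1)] u] .
  ultimately show "\<exists>u\<in>R - M. h = t powi k * u" by blast
next
  assume "\<exists>u\<in>R - M. h = t powi k * u"
  thus "has_order h k" unfolding has_order_def using generates by blast
qed

lemma has_order_nonzero: "has_order h k \<Longrightarrow> h \<noteq> 0"
  using unit_nonzero t_nonzero unfolding has_order_iff by auto

lemma has_order_unit: "u \<in> R - M \<Longrightarrow> has_order u 0"
  unfolding has_order_iff by auto

lemma has_order_t: "has_order t 1"
  unfolding has_order_iff using unit_one by force

lemma has_order_mult: assumes "has_order h k" "has_order h' k'" shows "has_order (h * h') (k + k')"
proof -
  obtain u v where "u \<in> R - M" "v \<in> R - M" "h = t powi k * u" "h' = t powi k' * v"
    using assms unfolding has_order_iff by blast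
  thus ?thesis unfolding has_order_iff using t_nonzero
    by (intro bexI[of _ "u * v"] unit_mult) (simp_all add: power_int_add)
qed

lemma has_order_inverse: assumes "has_order h k" shows "has_order (inverse h) (- k)"
proof -
  obtain u where "u \<in> R - M" "h = t powi k * u"
    using assms unfolding has_order_iff by blast
  thus ?thesis unfolding has_order_iff
    by (intro bexI[of _ "inverse u"] unit_inverse) (simp_all add: power_int_minus)
qed

lemma has_order_divide: "has_order h k \<Longrightarrow> has_order h' k' \<Longrightarrow> has_order (h / h') (k - k')"
  using has_order_mult[OF _ has_order_inverse] by (simp add: divide_inverse)

lemma has_order_power: "has_order h k \<Longrightarrow> has_order (h ^ n) (int n * k)"
proof (induction n)
  case 0 thus ?case using has_order_unit[OF unit_one] by simp
next
  case (Suc n) thus ?case using has_order_mult[of h k "h ^ n" "int n * k"] by (simp add: algebra_simps)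
qed

lemma mem_R_if_nonneg_order: assumes "has_order h k" "k \<ge> 0" shows "h \<in> R"
proof -
  obtain u where u: "u \<in> R - M" "h = t powi k * u" using assms unfolding has_order_iff by blast
  have "t ^ n \<in> R" for n
    by (induction n) (use one_mem_R R_mult t_mem_M M_subset_R in auto)
  with u assms(2) show ?thesis by (auto simp: power_int_def intro: R_mult)
qed

lemma mem_M_if_pos_order: assumes "has_order h k" "k > 0" shows "h \<in> M"
proof -
  have "has_order (h / t) (k - 1)" using has_order_divide[OF assms(1) has_order_t] .
  hence "h / t \<in> R" using assms(2) mem_R_if_nonneg_order by simp
  thus ?thesis unfolding M_iff using t_nonzero by (intro bexI[of _ "h / t"]) simp_all
qed

lemma has_order_unique: assumes "has_order h k" "has_order h k'" shows "k = k'"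
proof -
  have False if "k < k'" "has_order h k" "has_order h k'" for k k'
  proof -
    have "has_order (h / h) (k' - k)" using that has_order_divide by blast
    hence "1 \<in> M" using mem_M_if_pos_order[of "h / h"] has_order_nonzero that by simp
    thus False using one_not_mem_M by simp
  qed
  thus ?thesis using assms by (metis linorder_neqE)
qed

lemma the_order: "has_order h k \<Longrightarrow> (THE k. has_order h k) = k"
  using has_order_unique by blast

lemma nonneg_order_if_mem_R: assumes "has_order h k" "h \<in> R" shows "k \<ge> 0"
proof (rule ccontr)
  assume "\<not> k \<ge> 0"
  hence "inverse h \<in> M" using mem_M_if_pos_order[OF has_order_inverse[OF assms(1)]] by simp
  hence "h * inverse h \<in> M" by (rule M_mult[OF assms(2)])
  thus False using has_order_nonzero[OF assms(1)] one_not_mem_M by simp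
qed

lemma has_order_zero_iff: assumes "has_order h k" "h \<in> R" shows "k = 0 \<longleftrightarrow> h \<notin> M"
  using assms mem_M_if_pos_order nonneg_order_if_mem_R has_order_unit has_order_unique
  by (metis Diff_iff order_le_less has_order_iff power_int_0_right mult_1)

lemma has_order_add:
  assumes "has_order h k" "has_order h' k'" "k < k'"
  shows "has_order (h + h') k"
proof -
  have h: "h \<noteq> 0" using assms(1) by (rule has_order_nonzero)
  have "h' / h \<in> M"
    using mem_M_if_pos_order[OF has_order_divide[OF assms(2,1)]] assms(3) by simp
  hence "has_order (1 + h' / h) 0" using has_order_unit[OF unit_add_M[OF unit_one]] by blast
  from has_order_mult[OF assms(1) this] show ?thesis using h by (simp add: ring_distribs)
qed

text \<open>
  This replaces the noetherian hypothesis: a divisor in \<open>R\<close> of an element of order \<open>n\<close> can be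
  divided by \<open>t\<close> at most \<open>n\<close> times. It will be applied to \<open>p + q y\<close> as a factor of its norm.
\<close>

lemma has_order_if_divides_power:
  assumes "h \<in> R" "h' \<in> R" "has_order (h * h') (int n)"
  shows "\<exists>k. has_order h k"
  using assms
proof (induction n arbitrary: h)
  case 0
  have "h \<notin> M"
  proof
    assume "h \<in> M"
    hence "h * h' \<in> M" using M_mult[OF "0.prems"(2), of h] by (simp add: mult.commute[of h])
    thus False using "0.prems" has_order_zero_iff[of "h * h'" 0] R_mult by simp
  qed
  thus ?case using has_order_unit "0.prems" by blast
next
  case (Suc n)
  show ?case
  proof (cases "h \<in> M")
    case True
    then obtain u where u: "u \<in> R" "h = t * u" unfolding M_iff by blast
    have "has_order (h * h' / t) (int n)"
      using has_order_divide[OF Suc.prems(3) has_order_t] by simp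
    hence "has_order (u * h') (int n)" using u t_nonzero by simp
    then obtain k where "has_order u k" using Suc.IH[OF u(1)] Suc.prems by blast
    thus ?thesis using has_order_mult[OF has_order_t] u(2) by blast
  qed (use has_order_unit Suc.prems in blast)
qed

end

section \<open>Charts\<close>

text \<open>
  Both affine pieces of the smooth model have the same shape: functions \<open>x\<close> and \<open>y\<close> in a field
  \<open>L\<close> containing the constants, related by \<open>y\<^sup>2 = F(x)\<close>. The simple root \<open>c\<close> of \<open>F\<close> ensures
  that \<open>y\<close> is not in \<open>K(x)\<close>.
\<close>

locale quadratic_chart = unital_hom e
  for e :: "'a::alg_closed_field \<Rightarrow> 'l::field" +
  fixes F :: "'a poly" and x y :: 'l and c :: 'a
  assumes x_not_constant: "x \<notin> range e"
    and y_square: "y ^ 2 = poly_eval e x F"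
    and F_nonzero: "F \<noteq> 0"
    and simple_root: "Polynomial.order c F = 1"
begin

sublocale ev: unital_hom "poly_eval e x"
  by (rule unital_hom_poly_eval)

lemma hom_nonzero: "u \<noteq> 0 \<Longrightarrow> e u \<noteq> 0"
  using hom_mult[of u "inverse u"] by (auto simp: hom_one)

text \<open>
  Over an algebraically closed field it is enough that \<open>x\<close> is not a constant: a polynomial
  relation for \<open>x\<close> would split into linear factors, one of which vanishes.
\<close>

lemma poly_eval_nonzero: "p \<noteq> 0 \<Longrightarrow> poly_eval e x p \<noteq> 0"
proof (induction "Polynomial.degree p" arbitrary: p rule: less_induct)
  case less
  show ?case
  proof (cases "Polynomial.degree p = 0")
    case True
    then obtain u where "p = [:u:]" by (rule degree_eq_zeroE)
    thus ?thesis using less.prems hom_nonzero by (simp add: poly_eval_const)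
  next
    case False
    then obtain u where "poly p u = 0" using alg_closed_imp_poly_has_root by blast
    then obtain q where q: "p = [:- u, 1:] * q" by (metis dvdE poly_eq_0_iff_dvd)
    with less.prems have "q \<noteq> 0" by auto
    hence "Polynomial.degree q < Polynomial.degree p" unfolding q by (subst degree_mult_eq) auto
    hence "poly_eval e x q \<noteq> 0" using less.hyps \<open>q \<noteq> 0\<close> by blast
    moreover have "poly_eval e x [:- u, 1:] \<noteq> 0"
      using x_not_constant by (auto simp: poly_eval_linear hom_simps)
    ultimately show ?thesis unfolding q by (simp only: ev.hom_mult mult_eq_0_iff simp_thms)
  qed
qed

lemma poly_eval_inj: "poly_eval e x p = poly_eval e x q \<Longrightarrow> p = q"
  using poly_eval_nonzero[of "p - q"] by (auto simp: ev.hom_diff)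

text \<open>
  Comparing orders of vanishing at the simple root \<open>c\<close>: in \<open>p\<^sup>2 = q\<^sup>2 F\<close> the left side has even
  order and the right side odd order, so \<open>F(x)\<close> is not a square in \<open>K(x)\<close>. This works for both
  affine pieces of the curve, whereas the degree of \<open>F\<close> may be even on the piece at infinity.
\<close>

lemma linear_independence:
  assumes "poly_eval e x p + poly_eval e x q * y = 0"
  shows "p = 0 \<and> q = 0"
proof -
  have "poly_eval e x p = - (poly_eval e x q * y)"
    using assms by (simp add: eq_neg_iff_add_eq_0)
  hence "poly_eval e x p ^ 2 = poly_eval e x q ^ 2 * y ^ 2" by (simp add: power_mult_distrib)
  hence "poly_eval e x (p ^ 2) = poly_eval e x (q ^ 2 * F)"
    by (simp only: ev.hom_power ev.hom_mult y_square)
  hence eq: "p ^ 2 = q ^ 2 * F" by (rule poly_eval_inj)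
  have "q = 0"
  proof (rule ccontr)
    assume q: "q \<noteq> 0"
    hence p: "p \<noteq> 0" using eq F_nonzero by auto
    have "Polynomial.order c (p ^ 2) = Polynomial.order c (q ^ 2 * F)" unfolding eq ..
    hence "2 * Polynomial.order c p = 2 * Polynomial.order c q + 1"
      using p q F_nonzero simple_root by (simp add: order_mult power2_eq_square)
    thus False by presburger
  qed
  with eq show ?thesis by simp
qed

text \<open>
  The same \<open>p\<close> and \<open>q\<close> serve for the function and for its values at all points of the chart,
  which is what makes evaluation at a point compatible with the relation \<open>y\<^sup>2 = F(x)\<close>.
\<close>

lemma normal_form:
  "\<exists>p q. eval2 e r (x, y) = poly_eval e x p + poly_eval e x q * y \<and>
     (\<forall>a b. b ^ 2 = poly F a \<longrightarrow> eval2 id r (a, b) = poly p a + poly q a * b)"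
proof -
  obtain d p q where r: "r = d * [:- F, 0, 1:] + [:p, q:]"
    using linear_remainder[of r F] by blast
  interpret E: unital_hom "\<lambda>r. eval2 e r (x, y)" by (rule unital_hom_eval2)
  have curve: "eval2 e [:- F, 0, 1:] (x, y) = 0"
    unfolding eval2_conv_poly_eval using y_square
    by (simp add: unital_hom.poly_eval_pCons[OF unital_hom_poly_eval] ev.hom_simps power2_eq_square)
  have "eval2 e r (x, y) = poly_eval e x p + poly_eval e x q * y"
    unfolding r E.hom_add E.hom_mult curve by (simp add: eval2_linear)
  moreover have "eval2 id r (a, b) = poly p a + poly q a * b" if "b ^ 2 = poly F a" for a b
  proof -
    interpret I: unital_hom "id :: 'a \<Rightarrow> 'a" by (rule unital_hom_id)
    interpret E: unital_hom "\<lambda>r. eval2 id r (a, b)" by (rule I.unital_hom_eval2)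
    have curve: "eval2 id [:- F, 0, 1:] (a, b) = 0"
      unfolding eval2_conv_poly_eval using that
      by (simp add: unital_hom.poly_eval_pCons[OF I.unital_hom_poly_eval] power2_eq_square)
    show ?thesis
      unfolding r E.hom_add E.hom_mult curve by (simp add: I.eval2_linear)
  qed
  ultimately show ?thesis by blast
qed

text \<open>
  The product of \<open>p + q y\<close> with its image under the hyperelliptic involution \<open>y \<mapsto> - y\<close> is a
  polynomial in \<open>x\<close>; this is the norm from \<open>K(x, y)\<close> to \<open>K(x)\<close>.
\<close>

lemma norm_product:
  "(poly_eval e x p + poly_eval e x q * y) * (poly_eval e x p - poly_eval e x q * y) =
     poly_eval e x (p ^ 2 - q ^ 2 * F)"
  by (simp add: ev.hom_simps flip: y_square)
    (simp add: power2_eq_square algebra_simps)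

lemma norm_nonzero:
  assumes "p \<noteq> 0 \<or> q \<noteq> 0"
  shows "p ^ 2 - q ^ 2 * F \<noteq> 0"
proof
  assume "p ^ 2 - q ^ 2 * F = 0"
  hence "(poly_eval e x p + poly_eval e x q * y) * (poly_eval e x p + poly_eval e x (- q) * y) = 0"
    using norm_product[of p q] by (simp add: ev.hom_uminus)
  thus False using linear_independence[of p q] linear_independence[of p "- q"] assms by auto
qed

end

text \<open>
  A point \<open>(a, b)\<close> of a chart. The partial derivatives of \<open>y\<^sup>2 - F(x)\<close> at the point are
  \<open>2 b\<close> and \<open>- F'(a)\<close>, so for invertible \<open>2\<close> smoothness means that \<open>a\<close> is a simple root of
  \<open>F\<close> whenever \<open>b = 0\<close>.
\<close>

locale chart_point = quadratic_chart e F x y c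
  for e :: "'a::alg_closed_field \<Rightarrow> 'l::field" and F x y c +
  fixes a b :: 'a
  assumes on_curve: "b ^ 2 = poly F a"
    and smooth: "b = 0 \<Longrightarrow> Polynomial.order a F = 1"
    and two_nonzero: "(2::'a) \<noteq> 0"
begin

sublocale specialization "\<lambda>r. eval2 e r (x, y)" "\<lambda>r. eval2 id r (a, b)"
proof -
  interpret I: unital_hom "id :: 'a \<Rightarrow> 'a" by (rule unital_hom_id)
  interpret P: unital_hom "\<lambda>r. eval2 e r (x, y)" by (rule unital_hom_eval2)
  interpret Q: unital_hom "\<lambda>r. eval2 id r (a, b)" by (rule I.unital_hom_eval2)
  show "specialization (\<lambda>r. eval2 e r (x, y)) (\<lambda>r. eval2 id r (a, b))"
  proof
    fix r assume "eval2 e r (x, y) = 0"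
    with normal_form[of r] linear_independence on_curve show "eval2 id r (a, b) = 0"
      by (metis add_0 mult_zero_left poly_0)
  qed
qed

lemma poly_eval_mem_R: "poly_eval e x p \<in> R"
  and poly_eval_mem_M_iff: "poly_eval e x p \<in> M \<longleftrightarrow> poly p a = 0"
  and function_mem_R: "poly_eval e x p + poly_eval e x q * y \<in> R"
  and function_mem_M_iff: "poly_eval e x p + poly_eval e x q * y \<in> M \<longleftrightarrow> poly p a + poly q a * b = 0"
proof -
  interpret I: unital_hom "id :: 'a \<Rightarrow> 'a" by (rule unital_hom_id)
  show "poly_eval e x p \<in> R" "poly_eval e x p \<in> M \<longleftrightarrow> poly p a = 0"
    using image_mem_R[of "[:p:]"] image_mem_M_iff[of "[:p:]"]
    by (simp_all add: eval2_const I.eval2_const)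
  show "poly_eval e x p + poly_eval e x q * y \<in> R"
    "poly_eval e x p + poly_eval e x q * y \<in> M \<longleftrightarrow> poly p a + poly q a * b = 0"
    using image_mem_R[of "[:p, q:]"] image_mem_M_iff[of "[:p, q:]"]
    by (simp_all add: eval2_linear I.eval2_linear)
qed

lemma y_mem_R: "y \<in> R" and y_mem_M_iff: "y \<in> M \<longleftrightarrow> b = 0"
  using function_mem_R[of 0 1] function_mem_M_iff[of 0 1] by (simp_all add: ev.hom_simps)

lemma x_mem_M: "x - e a \<in> M"
  using poly_eval_mem_M_iff[of "[:- a, 1:]"] by (simp add: poly_eval_linear hom_simps)

lemma poly_eval_minus_root: "poly_eval e x ([:- a, 1:] * p) = (x - e a) * poly_eval e x p"
  by (simp only: ev.hom_mult poly_eval_linear) (simp add: hom_simps)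

text \<open>
  At a Weierstrass point \<open>(a, 0)\<close> the abscissa is ramified: since \<open>a\<close> is a simple root of \<open>F\<close>,
  \<open>y\<^sup>2 = F(x)\<close> is \<open>x - a\<close> up to a unit.
\<close>

lemma ramified:
  assumes "b = 0"
  shows "\<exists>u\<in>R - M. x - e a = y ^ 2 * u"
proof -
  obtain G where G: "F = [:- a, 1:] ^ Polynomial.order a F * G" "\<not> [:- a, 1:] dvd G"
    using order_decomp[OF F_nonzero, of a] by blast
  have F: "F = [:- a, 1:] * G" using G(1) smooth assms by simp
  have u: "poly_eval e x G \<in> R - M"
    using G(2) poly_eval_mem_R poly_eval_mem_M_iff by (simp add: poly_eq_0_iff_dvd)
  have "y ^ 2 = (x - e a) * poly_eval e x G"
    unfolding y_square F by (rule poly_eval_minus_root)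
  hence "x - e a = y ^ 2 * inverse (poly_eval e x G)"
    using unit_nonzero[OF u] by simp
  thus ?thesis using unit_inverse[OF u] by blast
qed

text \<open>
  Away from the Weierstrass points \<open>y + b\<close> is a unit, so that \<open>y - b = (F(x) - F(a)) / (y + b)\<close>
  is a multiple of \<open>x - a\<close>.
\<close>

lemma unramified:
  assumes "b \<noteq> 0"
  shows "\<exists>u\<in>R. y - e b = (x - e a) * u"
proof -
  have "poly (F - [:b ^ 2:]) a = 0" using on_curve by simp
  then obtain G where G: "F - [:b ^ 2:] = [:- a, 1:] * G"
    by (metis dvdE poly_eq_0_iff_dvd)
  have u: "y + e b \<in> R - M"
    using function_mem_R[of "[:b:]" 1] function_mem_M_iff[of "[:b:]" 1] assms two_nonzero
    by (simp add: poly_eval_const ev.hom_one add.commute flip: mult_2)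
  have "(y - e b) * (y + e b) = poly_eval e x (F - [:b ^ 2:])"
    by (simp add: ev.hom_diff poly_eval_const hom_power flip: y_square)
    (simp add: power2_eq_square algebra_simps)
  also have "\<dots> = (x - e a) * poly_eval e x G" unfolding G by (rule poly_eval_minus_root)
  finally have "y - e b = (x - e a) * (poly_eval e x G * inverse (y + e b))"
    using unit_nonzero[OF u] by (simp add: field_simps)
  moreover have "poly_eval e x G * inverse (y + e b) \<in> R"
    using R_mult poly_eval_mem_R unit_inverse[OF u] by blast
  ultimately show ?thesis by blast
qed

definition t :: 'l where "t = (if b = 0 then y else x - e a)"

lemma t_ramified: "b = 0 \<Longrightarrow> t = y" and t_unramified: "b \<noteq> 0 \<Longrightarrow> t = x - e a"
  unfolding t_def by simp_all

lemma generates_t: "generates t"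
proof (rule generatesI)
  show "t \<in> M" unfolding t_def using x_mem_M y_mem_M_iff by metis
next
  fix r assume r: "eval2 id r (a, b) = 0"
  obtain p q where pq: "eval2 e r (x, y) = poly_eval e x p + poly_eval e x q * y"
      and *: "poly p a + poly q a * b = 0"
    using normal_form[of r] on_curve r by auto
  show "\<exists>u\<in>R. eval2 e r (x, y) = t * u"
  proof (cases "b = 0")
    case True
    then obtain p' where p: "p = [:- a, 1:] * p'" using * by (auto simp: poly_eq_0_iff_dvd elim: dvdE)
    obtain u where u: "u \<in> R - M" "x - e a = y ^ 2 * u" using ramified[OF True] by blast
    have "eval2 e r (x, y) = y * (y * u * poly_eval e x p' + poly_eval e x q)"
      unfolding pq p poly_eval_minus_root u(2) by (simp add: power2_eq_square algebra_simps)
    moreover have "y * u * poly_eval e x p' + poly_eval e x q \<in> R"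
      using u(1) by (intro R_add R_mult y_mem_R poly_eval_mem_R) simp
    ultimately show ?thesis unfolding t_ramified[OF True] by blast
  next
    case False
    obtain u where u: "u \<in> R" "y - e b = (x - e a) * u" using unramified[OF False] by blast
    have "poly (p + smult b q) a = 0" using * by (simp add: mult.commute)
    then obtain p' where p': "p + smult b q = [:- a, 1:] * p'"
      by (metis dvdE poly_eq_0_iff_dvd)
    have "eval2 e r (x, y) = poly_eval e x (p + smult b q) + poly_eval e x q * (y - e b)"
      unfolding pq by (simp add: poly_eval_add poly_eval_smult algebra_simps)
    also have "\<dots> = (x - e a) * (poly_eval e x p' + poly_eval e x q * u)"
      unfolding p' poly_eval_minus_root u(2) by (simp add: algebra_simps)
    finally show ?thesis
      unfolding t_unramified[OF False] using R_add R_mult poly_eval_mem_R u(1) by blast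
  qed
qed

lemma t_nonzero: "t \<noteq> 0"
  using linear_independence[of 0 1] x_not_constant by (auto simp: t_def ev.hom_simps)

sublocale valuation "\<lambda>r. eval2 e r (x, y)" "\<lambda>r. eval2 id r (a, b)" t
  using generates_t t_nonzero by unfold_locales

definition ramification :: nat where "ramification = (if b = 0 then 2 else 1)"

lemma has_order_x: "has_order (x - e a) (int ramification)"
proof (cases "b = 0")
  case True
  then obtain u where "u \<in> R - M" "x - e a = y ^ 2 * u" using ramified by blast
  moreover have "t = y" "ramification = 2"
    using True unfolding t_ramified[OF True] ramification_def by simp_all
  ultimately show ?thesis
    using has_order_mult[OF has_order_power[OF has_order_t, of 2] has_order_unit[of u]] by simp
next
  case False
  thus ?thesis using has_order_t by (simp add: t_def ramification_def)
qed

lemma has_order_poly_eval: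
  assumes "p \<noteq> 0"
  shows "has_order (poly_eval e x p) (int (Polynomial.order a p * ramification))"
proof -
  obtain q where q: "p = [:- a, 1:] ^ Polynomial.order a p * q" "\<not> [:- a, 1:] dvd q"
    using order_decomp[OF assms, of a] by blast
  have "poly_eval e x p = poly_eval e x [:- a, 1:] ^ Polynomial.order a p * poly_eval e x q"
    by (subst q(1)) (simp only: ev.hom_simps)
  also have "poly_eval e x [:- a, 1:] = x - e a" by (simp add: poly_eval_linear hom_simps)
  finally have "poly_eval e x p = (x - e a) ^ Polynomial.order a p * poly_eval e x q" .
  moreover have "has_order (poly_eval e x q) 0"
    using q(2) poly_eval_mem_R poly_eval_mem_M_iff by (intro has_order_unit) (simp add: poly_eq_0_iff_dvd)
  ultimately show ?thesis
    using has_order_mult[OF has_order_power[OF has_order_x, of "Polynomial.order a p"]] by fastforce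
qed

lemma ex_order:
  assumes "p \<noteq> 0 \<or> q \<noteq> 0"
  shows "\<exists>k. has_order (poly_eval e x p + poly_eval e x q * y) k"
proof (rule has_order_if_divides_power)
  show "poly_eval e x p + poly_eval e x q * y \<in> R" by (rule function_mem_R)
  show "poly_eval e x p - poly_eval e x q * y \<in> R"
    using function_mem_R[of p "- q"] by (simp add: ev.hom_uminus)
  show "has_order ((poly_eval e x p + poly_eval e x q * y) * (poly_eval e x p - poly_eval e x q * y))
      (int (Polynomial.order a (p ^ 2 - q ^ 2 * F) * ramification))"
    unfolding norm_product by (rule has_order_poly_eval[OF norm_nonzero[OF assms]])
qed

text \<open>
  At a Weierstrass point \<open>x - a\<close> has order \<open>2\<close> and \<open>y\<close> has order \<open>1\<close>. If \<open>q(x) y\<close> is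
  divisible by \<open>x - a\<close> in the local ring, then \<open>q(x)\<close> is still divisible by \<open>y\<close> and vanishes at
  the point.
\<close>

lemma vanishes_if_multiple_of_uniformizer_square:
  assumes "b = 0" "h \<in> R" "poly_eval e x ([:- a, 1:] * p) + poly_eval e x q * y = (x - e a) * h"
  shows "poly q a = 0"
proof -
  obtain u where u: "u \<in> R - M" "x - e a = y ^ 2 * u" using ramified[OF assms(1)] by blast
  have "y \<noteq> 0" using t_nonzero unfolding t_ramified[OF assms(1)] .
  have "y * poly_eval e x q = y * (y * (u * (h - poly_eval e x p)))"
    using assms(3) unfolding poly_eval_minus_root u(2) by (simp add: power2_eq_square algebra_simps)
  hence "poly_eval e x q = (u * (h - poly_eval e x p)) * y" using \<open>y \<noteq> 0\<close> by simp
  also have "\<dots> \<in> M"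
    using u(1) assms(1,2) y_mem_M_iff by (intro M_mult R_mult R_diff poly_eval_mem_R) simp_all
  finally show ?thesis by (simp only: poly_eval_mem_M_iff)
qed

end

section \<open>The two charts of the hyperelliptic curve\<close>

lemma unital_hom_poly_fun: "unital_hom poly_fun"
  by unfold_locales (simp_all add: poly_fun_def)

interpretation poly_fun: unital_hom poly_fun
  by (rule unital_hom_poly_fun)

lemma unital_hom_const_fun: "unital_hom const_fun"
  by unfold_locales
    (simp_all add: const_fun_def poly_fun.hom_one
      mult.commute flip: one_pCons poly_fun.hom_add poly_fun.hom_mult)

interpretation const_fun: unital_hom const_fun
  by (rule unital_hom_const_fun)

lemma poly_fun_eq_iff: "poly_fun p = poly_fun q \<longleftrightarrow> p = q"
  by (simp add: poly_fun_def)

lemma poly_fun_eq_0_iff: "poly_fun p = 0 \<longleftrightarrow> p = 0"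
  by (simp add: poly_fun_def)

lemma poly_eval_x_fun: "poly_eval const_fun x_fun p = poly_fun p"
proof (induction p)
  case (pCons a p)
  have "poly_fun (pCons a p) = poly_fun ([:a:] + [:0, 1:] * p)" by simp
  also have "\<dots> = const_fun a + x_fun * poly_fun p"
    unfolding poly_fun.hom_add poly_fun.hom_mult const_fun_def x_fun_def ..
  finally show ?case using pCons.IH by (simp add: const_fun.poly_eval_pCons)
qed (simp add: poly_fun.hom_zero)

lemma poly_fun_linear: "poly_fun [:- a, 1:] = x_fun - const_fun a"
  unfolding poly_eval_x_fun[symmetric]
  by (simp add: const_fun.poly_eval_linear const_fun.hom_simps)

lemma x_fun_nonzero [simp]: "x_fun \<noteq> 0"
  unfolding x_fun_def poly_fun_eq_0_iff by simp

lemma x_fun_not_constant: "x_fun \<notin> range const_fun"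
  unfolding x_fun_def const_fun_def by (auto simp: poly_fun_eq_iff)

lemma inverse_x_fun_not_constant: "1 / (x_fun :: 'a::field function_over) \<notin> range const_fun"
proof
  assume "1 / (x_fun :: 'a function_over) \<in> range const_fun"
  then obtain c :: 'a where "1 / x_fun = const_fun c" by blast
  hence "1 = const_fun c * x_fun" by (simp add: field_simps)
  hence "poly_fun 1 = poly_fun ([:c:] * [:0, 1:])"
    unfolding const_fun_def x_fun_def poly_fun.hom_mult poly_fun.hom_one .
  hence "1 = [:c:] * [:0, 1:]" unfolding poly_fun_eq_iff .
  hence "poly 1 0 = poly ([:c:] * [:0, 1:]) 0" by (rule arg_cong)
  thus False by simp
qed

lemma order_linear_times:
  fixes p :: "'a::idom poly"
  assumes "poly p a \<noteq> 0"
  shows "Polynomial.order a ([:- a, 1:] * p) = 1"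
proof -
  have "p \<noteq> 0" using assms by auto
  hence "Polynomial.order a ([:- a, 1:] * p) = Polynomial.order a [:- a, 1:] + Polynomial.order a p"
    by (intro order_mult) (simp only: mult_eq_0_iff pCons_eq_0_iff one_neq_zero simp_thms)
  thus ?thesis using order_power_n_n[of a 1] order_0I[OF assms] by simp
qed

locale hyperelliptic_curve =
  fixes \<alpha> :: "nat \<Rightarrow> 'a::alg_closed_field" and g :: nat
  assumes char_not_2: "CHAR('a) \<noteq> 2"
    and distinct_roots: "inj_on \<alpha> {1..2*g+1}"
begin

abbreviation "f \<equiv> curve_poly \<alpha> g"
abbreviation "y \<equiv> y_fun \<alpha> g"
text \<open>
  With \<open>v = 1 / x\<close> this is \<open>v\<^bsup>2g+2\<^esup> f(1 / v)\<close>, the right-hand side of the equation of the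
  chart at infinity; the point at infinity is its simple root \<open>v = 0\<close>.
\<close>

definition f_infinity :: "'a poly" where
  "f_infinity = [:0, 1:] * (\<Prod>i\<in>{1..2*g+1}. [:1, - \<alpha> i:])"

lemma two_nonzero: "(2::'a) \<noteq> 0"
proof
  assume "(2::'a) = 0"
  hence "CHAR('a) dvd 2" using of_nat_eq_0_iff_char_dvd[of 2, where 'a = 'a] by simp
  hence "CHAR('a) = 1 \<or> CHAR('a) = 2" using prime_nat_iff two_is_prime_nat by blast
  thus False using char_not_2 by simp
qed

lemma f_nonzero: "f \<noteq> 0"
  unfolding curve_poly_def by (subst prod_zero_iff) auto

lemma f_root_iff: "poly f a = 0 \<longleftrightarrow> (\<exists>i\<in>{1..2*g+1}. a = \<alpha> i)"
  unfolding curve_poly_def poly_prod prod_zero_iff[OF finite_atLeastAtMost]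
  by (intro bex_cong refl) auto

lemma f_simple_root:
  assumes "poly f a = 0"
  shows "Polynomial.order a f = 1"
proof -
  obtain i where i: "i \<in> {1..2*g+1}" "a = \<alpha> i" using assms f_root_iff by blast
  have "f = [:- a, 1:] * (\<Prod>j\<in>{1..2*g+1} - {i}. [:- \<alpha> j, 1:])"
    unfolding curve_poly_def i(2) using i(1) by (intro prod.remove) auto
  moreover have "poly (\<Prod>j\<in>{1..2*g+1} - {i}. [:- \<alpha> j, 1:]) a \<noteq> 0"
    using i distinct_roots by (auto simp: poly_prod inj_on_def)
  ultimately show ?thesis by (metis order_linear_times)
qed

lemma y_square: "y ^ 2 = poly_fun f"
  unfolding y_fun_def by (rule someI_ex[OF nth_root_exists]) simp

lemma affine_chart: "quadratic_chart const_fun f x_fun y (\<alpha> 1)"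
proof
  have "poly f (\<alpha> 1) = 0" unfolding f_root_iff by (rule bexI[of _ 1]) auto
  thus "Polynomial.order (\<alpha> 1) f = 1" by (rule f_simple_root)
qed (simp_all only: x_fun_not_constant poly_eval_x_fun y_square f_nonzero not_False_eq_True)

sublocale affine: quadratic_chart const_fun f x_fun y "\<alpha> 1"
  by (rule affine_chart)

lemma f_infinity_simple_root: "Polynomial.order 0 f_infinity = 1"
  using order_linear_times[of "\<Prod>i\<in>{1..2*g+1}. [:1, - \<alpha> i:]" 0]
  by (simp add: poly_prod f_infinity_def)

lemma f_infinity_root: "poly f_infinity 0 = 0"
  by (simp add: f_infinity_def)

lemma infinity_chart: "quadratic_chart const_fun f_infinity (1 / x_fun) (y / x_fun ^ (g + 1)) 0"
proof
  show "1 / x_fun \<notin> range const_fun" by (rule inverse_x_fun_not_constant)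
  show "f_infinity \<noteq> 0" unfolding f_infinity_def by (subst mult_eq_0_iff, subst prod_zero_iff) auto
  show "Polynomial.order 0 f_infinity = 1" by (rule f_infinity_simple_root)
  interpret v: unital_hom "poly_eval const_fun (1 / x_fun)" by (rule const_fun.unital_hom_poly_eval)
  have "poly_fun [:- a, 1:] = x_fun * poly_eval const_fun (1 / x_fun) [:1, - a:]" for a :: 'a
    
    by (simp add: poly_fun_linear const_fun.poly_eval_linear const_fun.hom_simps field_simps)
  hence "poly_fun f = x_fun ^ (2*g+1) * poly_eval const_fun (1 / x_fun) (\<Prod>i\<in>{1..2*g+1}. [:1, - \<alpha> i:])"
    unfolding curve_poly_def poly_fun.hom_prod v.hom_prod by (simp add: prod.distrib)
  also have "\<dots> = x_fun ^ (2*g+2) * poly_eval const_fun (1 / x_fun) f_infinity"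
    unfolding f_infinity_def v.hom_mult 
    by (simp add: const_fun.poly_eval_linear const_fun.hom_simps)
  finally have "poly_fun f = (x_fun ^ (g + 1)) ^ 2 * poly_eval const_fun (1 / x_fun) f_infinity"
    by (simp add: power_mult_distrib power2_eq_square power_mult algebra_simps)
  thus "(y / x_fun ^ (g + 1)) ^ 2 = poly_eval const_fun (1 / x_fun) f_infinity"
    unfolding power_divide y_square by simp
qed

lemma affine_point:
  assumes "b ^ 2 = poly f a"
  shows "chart_point const_fun f x_fun y (\<alpha> 1) a b"
  using assms two_nonzero f_simple_root[of a]
  by (intro chart_point.intro affine_chart) (unfold_locales, auto)

lemma infinity_point:
  "chart_point const_fun f_infinity (1 / x_fun) (y / x_fun ^ (g + 1)) 0 0 0"
  using two_nonzero f_infinity_simple_root f_infinity_root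
  by (intro chart_point.intro infinity_chart) (unfold_locales, auto)

lemma affine_point_iff: "Affine a b \<in> curve_points \<alpha> g \<longleftrightarrow> b ^ 2 = poly f a"
  and infinity_mem: "Infinity \<in> curve_points \<alpha> g"
  by (auto simp: curve_points_def)

section \<open>Orders of functions at the points of the curve\<close>

abbreviation function_at :: "'a curve_point \<Rightarrow> 'a poly poly \<Rightarrow> 'a function_over" where
  "function_at P r \<equiv> eval2 const_fun r (coord_funs \<alpha> g P)"

abbreviation value_at :: "'a curve_point \<Rightarrow> 'a poly poly \<Rightarrow> 'a" where
  "value_at P r \<equiv> eval2 id r (coord_values P)"

abbreviation "is_order P \<equiv> specialization.has_order (function_at P) (value_at P)"

text \<open>
  The point at infinity is a Weierstrass point of the second chart, so the local analysis of charts
  covers every point of the curve.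
\<close>

lemma ex_valuation:
  assumes "P \<in> curve_points \<alpha> g"
  shows "\<exists>t. valuation (function_at P) (value_at P) t"
proof (cases P)
  case (Affine a b)
  then interpret chart_point const_fun f x_fun y "\<alpha> 1" a b
    using assms by (intro affine_point) (simp add: affine_point_iff)
  show ?thesis using valuation_axioms Affine by auto
next
  case Infinity
  interpret chart_point const_fun f_infinity "1 / x_fun" "y / x_fun ^ (g + 1)" 0 0 0
    by (rule infinity_point)
  show ?thesis using valuation_axioms Infinity by auto
qed

lemma order_at_eq:
  assumes "P \<in> curve_points \<alpha> g" "is_order P h k"
  shows "order_at \<alpha> g P h = k"
proof -
  obtain t where "valuation (function_at P) (value_at P) t" using ex_valuation assms(1) by blast
  then interpret valuation "function_at P" "value_at P" t .
  have "local_ring \<alpha> g P = R" "max_ideal \<alpha> g P = M"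
    unfolding local_ring_def max_ideal_def R_def M_def by simp_all
  hence "order_at \<alpha> g P h = (THE k. has_order h k)"
    unfolding order_at_def has_order_def uniformizer_def generates_def by simp
  thus ?thesis using the_order[OF assms(2)] by simp
qed

lemma is_order_one: "P \<in> curve_points \<alpha> g \<Longrightarrow> is_order P 1 0"
  using ex_valuation valuation.has_order_unit specialization.unit_one valuation.axioms(1) by metis

lemma is_order_mult:
  "P \<in> curve_points \<alpha> g \<Longrightarrow> is_order P h k \<Longrightarrow> is_order P h' k' \<Longrightarrow> is_order P (h * h') (k + k')"
  using ex_valuation valuation.has_order_mult by metis

lemma is_order_inverse:
  "P \<in> curve_points \<alpha> g \<Longrightarrow> is_order P h k \<Longrightarrow> is_order P (inverse h) (- k)"
  using ex_valuation valuation.has_order_inverse by metis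

lemma is_order_divide:
  "P \<in> curve_points \<alpha> g \<Longrightarrow> is_order P h k \<Longrightarrow> is_order P h' k' \<Longrightarrow> is_order P (h / h') (k - k')"
  using ex_valuation valuation.has_order_divide by metis

lemma is_order_add:
  "P \<in> curve_points \<alpha> g \<Longrightarrow> is_order P h k \<Longrightarrow> is_order P h' k' \<Longrightarrow> k < k' \<Longrightarrow> is_order P (h + h') k"
  using ex_valuation valuation.has_order_add by metis

lemma is_order_power:
  "P \<in> curve_points \<alpha> g \<Longrightarrow> is_order P h k \<Longrightarrow> is_order P (h ^ n) (int n * k)"
  using ex_valuation valuation.has_order_power by metis

lemma is_order_infinity_x: "is_order Infinity x_fun (- 2)"
  and is_order_infinity_const: "a \<noteq> 0 \<Longrightarrow> is_order Infinity (const_fun a) 0"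
  and is_order_infinity_w: "is_order Infinity (y / x_fun ^ (g + 1)) 1"
proof -
  interpret chart_point const_fun f_infinity "1 / x_fun" "y / x_fun ^ (g + 1)" 0 0 0
    by (rule infinity_point)
  have "has_order (1 / x_fun) 2"
    using has_order_x unfolding ramification_def const_fun.hom_zero by simp
  hence "has_order (inverse (1 / x_fun)) (- 2)" by (rule has_order_inverse)
  moreover have "inverse (1 / x_fun) = (x_fun :: 'a function_over)" by simp
  ultimately show "is_order Infinity x_fun (- 2)"
    by (simp only: coord_funs.simps coord_values.simps)
  show "is_order Infinity (const_fun a) 0" if "a \<noteq> 0"
  proof -
    have "Polynomial.order 0 [:a:] = 0" using that by (intro order_0I) simp
    thus ?thesis using has_order_poly_eval[of "[:a:]"] that
      unfolding const_fun.poly_eval_const coord_funs.simps coord_values.simps by simp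
  qed
  show "is_order Infinity (y / x_fun ^ (g + 1)) 1"
    using has_order_t unfolding t_ramified[OF refl] coord_funs.simps coord_values.simps .
qed

text \<open>
  At infinity \<open>x\<close> has a double pole, so the leading term of a polynomial dominates.
\<close>

lemma is_order_infinity_poly_fun:
  assumes "p \<noteq> 0"
  shows "is_order Infinity (poly_fun p) (- 2 * int (Polynomial.degree p))"
  using assms
proof (induction p)
  case (pCons a p)
  have eq: "poly_fun (pCons a p) = x_fun * poly_fun p + const_fun a"
    unfolding poly_eval_x_fun[symmetric] by (simp add: const_fun.poly_eval_pCons)
  show ?case
  proof (cases "p = 0")
    case True
    hence "poly_fun (pCons a p) = const_fun a" "Polynomial.degree (pCons a p) = 0" "a \<noteq> 0"
      using pCons.prems by (simp_all add: const_fun_def)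
    thus ?thesis using is_order_infinity_const by (simp only: of_nat_0 mult_zero_right)
  next
    case False
    have "is_order Infinity (x_fun * poly_fun p) (- 2 + - 2 * int (Polynomial.degree p))"
      by (rule is_order_mult[OF infinity_mem is_order_infinity_x pCons.IH[OF False]])
    also have "- 2 + - 2 * int (Polynomial.degree p) = - 2 * int (Polynomial.degree (pCons a p))"
      using False by simp
    finally have *: "is_order Infinity (x_fun * poly_fun p) (- 2 * int (Polynomial.degree (pCons a p)))" .
    show ?thesis
    proof (cases "a = 0")
      case True
      thus ?thesis using * unfolding eq by (simp only: const_fun.hom_zero add_0_right)
    next
      case a: False
      have "- 2 * int (Polynomial.degree (pCons a p)) < 0" using False by simp
      thus ?thesis
        unfolding eq by (rule is_order_add[OF infinity_mem * is_order_infinity_const[OF a]])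
    qed
  qed
qed simp

text \<open>
  Here \<open>y = w x\<^bsup>g+1\<^esup>\<close>, where \<open>w\<close> is a uniformizer at infinity.
\<close>

lemma is_order_infinity_y: "is_order Infinity y (- (2 * int g + 1))"
proof -
  have "is_order Infinity (y / x_fun ^ (g + 1) * x_fun ^ (g + 1)) (1 + int (g + 1) * (- 2))"
    by (intro is_order_mult infinity_mem is_order_infinity_w is_order_power is_order_infinity_x)
  moreover have "y / x_fun ^ (g + 1) * x_fun ^ (g + 1) = y" by simp
  moreover have "1 + int (g + 1) * (- 2) = - (2 * int g + 1)" by simp
  ultimately show ?thesis by (simp only:)
qed

text \<open>
  The pole orders at infinity of \<open>p(x)\<close> and \<open>q(x) y\<close> have different parities, so there is no
  cancellation. Hence a function \<open>p(x) + q(x) y\<close> with \<open>q \<noteq> 0\<close> has a pole of order at least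
  \<open>2g + 1\<close>: this is the origin of the bound on \<open>n\<close>.
\<close>

lemma is_order_infinity_sum:
  assumes "p \<noteq> 0 \<or> q \<noteq> 0"
  shows "\<exists>k. is_order Infinity (poly_fun p + poly_fun q * y) k \<and>
           (q \<noteq> 0 \<longrightarrow> k \<le> - (2 * int g + 1))"
proof -
  let ?k = "- 2 * int (Polynomial.degree p)"
  let ?l = "- 2 * int (Polynomial.degree q) + - (2 * int g + 1)"
  have p: "is_order Infinity (poly_fun p) ?k" if "p \<noteq> 0"
    by (rule is_order_infinity_poly_fun[OF that])
  have q: "is_order Infinity (poly_fun q * y) ?l" if "q \<noteq> 0"
    by (intro is_order_mult infinity_mem is_order_infinity_poly_fun is_order_infinity_y that)
  consider "q = 0" | "p = 0" "q \<noteq> 0" | "p \<noteq> 0" "q \<noteq> 0" "?k < ?l" | "p \<noteq> 0" "q \<noteq> 0" "?l < ?k"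
    by (cases "?k = ?l") (presburger, linarith)
  thus ?thesis
  proof cases
    case 1
    thus ?thesis using p assms by (intro exI[of _ ?k]) (simp add: poly_fun.hom_zero)
  next
    case 2
    thus ?thesis using q by (intro exI[of _ ?l]) (simp add: poly_fun.hom_zero)
  next
    case 3
    thus ?thesis using is_order_add[OF infinity_mem p q] by (intro exI[of _ ?k]) simp
  next
    case 4
    thus ?thesis using is_order_add[OF infinity_mem q p] by (intro exI[of _ ?l]) (simp add: add.commute)
  qed
qed

section \<open>The function field\<close>

text \<open>
  Multiplying numerator and denominator by the conjugate of the denominator makes the denominator
  a polynomial in \<open>x\<close>.
\<close>

lemma function_field_normal_form:
  assumes "h \<in> function_field \<alpha> g"
  shows "\<exists>p q s. s \<noteq> 0 \<and> h = (poly_fun p + poly_fun q * y) / poly_fun s"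
proof -
  obtain r s where h: "h = eval2 const_fun r (x_fun, y) / eval2 const_fun s (x_fun, y)"
      and s: "eval2 const_fun s (x_fun, y) \<noteq> 0"
    using assms unfolding function_field_def by blast
  obtain p q where r: "eval2 const_fun r (x_fun, y) = poly_fun p + poly_fun q * y"
    using affine.normal_form[of r] unfolding poly_eval_x_fun by blast
  obtain p' q' where s': "eval2 const_fun s (x_fun, y) = poly_fun p' + poly_fun q' * y"
    using affine.normal_form[of s] unfolding poly_eval_x_fun by blast
  have nz: "p' \<noteq> 0 \<or> q' \<noteq> 0" using s s' by (auto simp: poly_fun.hom_zero)
  \<comment> \<open>The norm of the denominator.\<close>
  define N where "N = p' ^ 2 - q' ^ 2 * f"
  have N: "N \<noteq> 0" unfolding N_def by (rule affine.norm_nonzero[OF nz])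
  have NN: "(poly_fun p' + poly_fun q' * y) * (poly_fun p' - poly_fun q' * y) = poly_fun N"
    using affine.norm_product[of p' q'] unfolding poly_eval_x_fun N_def .
  hence "poly_fun p' - poly_fun q' * y \<noteq> 0" using N poly_fun_eq_0_iff by force
  hence "h = (poly_fun p + poly_fun q * y) * (poly_fun p' - poly_fun q' * y) / poly_fun N"
    unfolding h r s' NN[symmetric] by simp
  also have "(poly_fun p + poly_fun q * y) * (poly_fun p' - poly_fun q' * y) =
      poly_fun (p * p' - q * q' * f) + poly_fun (q * p' - p * q') * y"
    by (simp add: poly_fun.hom_simps flip: y_square) (simp add: power2_eq_square algebra_simps)
  finally show ?thesis using N by blast
qed

lemma one_mem_function_field: "1 \<in> function_field \<alpha> g"
proof -
  interpret E: unital_hom "\<lambda>r. eval2 const_fun r (x_fun, y)" by (rule const_fun.unital_hom_eval2)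
  show ?thesis unfolding function_field_def by (auto simp: E.hom_one intro!: exI[of _ 1])
qed

lemma poly_fun_mem_function_field: "poly_fun p \<in> function_field \<alpha> g"
proof -
  interpret E: unital_hom "\<lambda>r. eval2 const_fun r (x_fun, y)" by (rule const_fun.unital_hom_eval2)
  have "poly_fun p = eval2 const_fun [:p:] (x_fun, y) / eval2 const_fun 1 (x_fun, y)"
    by (simp add: E.hom_one const_fun.eval2_const poly_eval_x_fun)
  moreover have "eval2 const_fun 1 (x_fun, y) \<noteq> 0" by (simp add: E.hom_one)
  ultimately show ?thesis unfolding function_field_def by blast
qed

lemma mult_mem_function_field:
  assumes "h \<in> function_field \<alpha> g" "h' \<in> function_field \<alpha> g"
  shows "h * h' \<in> function_field \<alpha> g"
proof -
  interpret E: unital_hom "\<lambda>r. eval2 const_fun r (x_fun, y)" by (rule const_fun.unital_hom_eval2)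
  obtain r s r' s' where
    "h = eval2 const_fun r (x_fun, y) / eval2 const_fun s (x_fun, y)"
    "eval2 const_fun s (x_fun, y) \<noteq> 0"
    "h' = eval2 const_fun r' (x_fun, y) / eval2 const_fun s' (x_fun, y)"
    "eval2 const_fun s' (x_fun, y) \<noteq> 0"
    using assms unfolding function_field_def by blast
  hence "h * h' = eval2 const_fun (r * r') (x_fun, y) / eval2 const_fun (s * s') (x_fun, y)"
    "eval2 const_fun (s * s') (x_fun, y) \<noteq> 0"
    by (simp_all add: E.hom_mult)
  thus ?thesis unfolding function_field_def by blast
qed

lemma inverse_mem_function_field:
  assumes "h \<in> function_field \<alpha> g" "h \<noteq> 0"
  shows "inverse h \<in> function_field \<alpha> g"
proof -
  obtain r s where
    "h = eval2 const_fun r (x_fun, y) / eval2 const_fun s (x_fun, y)"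
    "eval2 const_fun s (x_fun, y) \<noteq> 0"
    using assms unfolding function_field_def by blast
  hence "inverse h = eval2 const_fun s (x_fun, y) / eval2 const_fun r (x_fun, y)"
    "eval2 const_fun r (x_fun, y) \<noteq> 0"
    using assms(2) by auto
  thus ?thesis unfolding function_field_def by blast
qed

lemma ex_is_order:
  assumes "P \<in> curve_points \<alpha> g" "h \<in> function_field \<alpha> g - {0}"
  shows "\<exists>k. is_order P h k"
proof -
  obtain p q s where s: "s \<noteq> 0" and h: "h = (poly_fun p + poly_fun q * y) / poly_fun s"
    using function_field_normal_form assms(2) by blast
  have pq: "p \<noteq> 0 \<or> q \<noteq> 0" using assms(2) h by (auto simp: poly_fun.hom_zero)
  have "\<exists>k. is_order P (poly_fun p + poly_fun q * y) k" if "p \<noteq> 0 \<or> q \<noteq> 0" for p q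
  proof (cases P)
    case (Affine a b)
    then interpret chart_point const_fun f x_fun y "\<alpha> 1" a b
      using assms(1) by (intro affine_point) (simp add: affine_point_iff)
    show ?thesis using ex_order[OF that] Affine by (simp add: poly_eval_x_fun)
  next
    case Infinity
    thus ?thesis using is_order_infinity_sum[OF that] by blast
  qed
  from this[OF pq] this[of s 0] s obtain k l where
    "is_order P (poly_fun p + poly_fun q * y) k" "is_order P (poly_fun s) l"
    by (auto simp: poly_fun.hom_zero)
  thus ?thesis unfolding h using is_order_divide[OF assms(1)] by blast
qed

lemma is_order_order_at:
  "P \<in> curve_points \<alpha> g \<Longrightarrow> h \<in> function_field \<alpha> g - {0} \<Longrightarrow> is_order P h (order_at \<alpha> g P h)"
  using ex_is_order order_at_eq by metis

section \<open>Functions regular on the affine curve\<close>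

text \<open>
  A root \<open>a\<close> of the denominator is a common root of all coefficients. Regularity of \<open>h\<close> at
  \<open>(a, b)\<close> and at \<open>(a, - b)\<close> gives \<open>p(a) + q(a) b = 0\<close> and \<open>p(a) - q(a) b = 0\<close>, hence
  \<open>p(a) = 0\<close> and \<open>q(a) b = 0\<close>. When \<open>b = 0\<close> the two points coincide and the double zero of
  \<open>x - a\<close> supplies the missing condition.
\<close>

lemma regular_numerators_vanish:
  assumes "s \<noteq> 0" "poly s a = 0" "h \<in> function_field \<alpha> g - {0}"
    and h: "h = (poly_fun p + poly_fun q * y) / poly_fun s"
    and regular: "\<And>a b. b ^ 2 = poly f a \<Longrightarrow> 0 \<le> order_at \<alpha> g (Affine a b) h"
  shows "poly p a = 0 \<and> poly q a = 0"
proof -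
  obtain b where b: "b ^ 2 = poly f a" using nth_root_exists[of 2 "poly f a"] by auto
  have hs: "poly_fun p + poly_fun q * y = h * poly_fun s"
    unfolding h using assms(1) by (simp add: poly_fun_eq_0_iff)
  have *: "poly p a + poly q a * b = 0 \<and> (b = 0 \<longrightarrow> poly p a = 0 \<longrightarrow> poly q a = 0)"
    if b: "b ^ 2 = poly f a" for b
  proof -
    interpret chart_point const_fun f x_fun y "\<alpha> 1" a b by (rule affine_point[OF b])
    have "is_order (Affine a b) h (order_at \<alpha> g (Affine a b) h)"
      using b assms(3) by (intro is_order_order_at) (simp_all add: affine_point_iff)
    hence "has_order h (order_at \<alpha> g (Affine a b) h)"
      by (simp only: coord_funs.simps coord_values.simps)
    hence hR: "h \<in> R" using regular[OF b] by (rule mem_R_if_nonneg_order)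
    have "h * poly_fun s \<in> M"
      using M_mult[OF hR] poly_eval_mem_M_iff[of s] assms(2) unfolding poly_eval_x_fun by blast
    hence "poly p a + poly q a * b = 0"
      using function_mem_M_iff[of p q] unfolding poly_eval_x_fun hs by blast
    moreover have "poly q a = 0" if b0: "b = 0" and "poly p a = 0"
    proof -
      obtain p' where p': "p = [:- a, 1:] * p'"
        using \<open>poly p a = 0\<close> by (metis dvdE poly_eq_0_iff_dvd)
      obtain s' where s': "s = [:- a, 1:] * s'"
        using \<open>poly s a = 0\<close> by (metis dvdE poly_eq_0_iff_dvd)
      have "poly_fun ([:- a, 1:] * p') + poly_fun q * y = (x_fun - const_fun a) * (poly_fun s' * h)"
        using hs unfolding p' s' poly_fun.hom_mult poly_fun_linear by (simp add: algebra_simps)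
      moreover have "poly_fun s' * h \<in> R"
        using R_mult[OF poly_eval_mem_R[of s'] hR] unfolding poly_eval_x_fun .
      ultimately show ?thesis
        using vanishes_if_multiple_of_uniformizer_square[OF b0, of "poly_fun s' * h" p' q]
        unfolding poly_eval_x_fun by blast
    qed
    ultimately show ?thesis by blast
  qed
  have plus: "poly p a + poly q a * b = 0" and minus: "poly p a - poly q a * b = 0"
    using *[OF b] *[of "- b"] b by simp_all
  have "2 * poly p a = (poly p a + poly q a * b) + (poly p a - poly q a * b)" by simp
  hence "2 * poly p a = 0" unfolding plus minus by simp
  hence p: "poly p a = 0" using two_nonzero by simp
  thus ?thesis using plus *[OF b] by auto
qed

text \<open>
  Common linear factors are cancelled until the denominator is constant. This is the
  fact that the coordinate ring \<open>K[x, y]\<close> is the intersection of its local rings, in elementary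
  terms.
\<close>

lemma regular_imp_polynomial:
  assumes "h \<in> function_field \<alpha> g - {0}"
    and regular: "\<And>a b. b ^ 2 = poly f a \<Longrightarrow> 0 \<le> order_at \<alpha> g (Affine a b) h"
  shows "\<exists>p q. h = poly_fun p + poly_fun q * y"
proof -
  have "\<exists>p q. h = poly_fun p + poly_fun q * y"
    if "s \<noteq> 0" "h = (poly_fun p + poly_fun q * y) / poly_fun s" for p q s
    using that
  proof (induction "Polynomial.degree s" arbitrary: p q s rule: less_induct)
    case less
    show ?case
    proof (cases "Polynomial.degree s = 0")
      case True
      then obtain c where s: "s = [:c:]" by (rule degree_eq_zeroE)
      have c: "c \<noteq> 0" using less.prems(1) s by simp
      have "poly_fun [:1 / c:] * poly_fun s = 1"
        using c by (simp add: s poly_fun.hom_one flip: poly_fun.hom_mult one_pCons)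
      hence "1 / poly_fun s = poly_fun [:1 / c:]" by (simp add: divide_eq_eq) (metis mult_zero_right zero_neq_one)
      hence "h = poly_fun p * poly_fun [:1 / c:] + poly_fun q * poly_fun [:1 / c:] * y"
        unfolding less.prems(2) by (simp add: divide_inverse algebra_simps)
      thus ?thesis unfolding poly_fun.hom_mult[symmetric] by blast
    next
      case False
      then obtain a where a: "poly s a = 0" using alg_closed_imp_poly_has_root by blast
      have "poly p a = 0" "poly q a = 0"
        using regular_numerators_vanish[OF less.prems(1) a assms(1) less.prems(2) regular] by auto
      then obtain p' q' s' where pqs: "p = [:- a, 1:] * p'" "q = [:- a, 1:] * q'" "s = [:- a, 1:] * s'"
        using a by (metis dvdE poly_eq_0_iff_dvd)
      have s': "s' \<noteq> 0" using less.prems(1) pqs by auto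
      have "poly_fun [:- a, 1:] \<noteq> 0" by (simp add: poly_fun_eq_0_iff)
      moreover have "h = poly_fun [:- a, 1:] * (poly_fun p' + poly_fun q' * y)
          / (poly_fun [:- a, 1:] * poly_fun s')"
        unfolding less.prems(2) pqs poly_fun.hom_mult by (simp add: algebra_simps)
      ultimately have "h = (poly_fun p' + poly_fun q' * y) / poly_fun s'" by simp
      moreover have "Polynomial.degree s' < Polynomial.degree s"
        unfolding pqs(3) using s' by (subst degree_mult_eq) auto
      ultimately show ?thesis using less.hyps s' by blast
    qed
  qed
  thus ?thesis using function_field_normal_form[of h] assms(1) by blast
qed

text \<open>
  The function \<open>h\<close> is regular on the affine curve and its pole at infinity has order less than
  \<open>2g + 1\<close>, so it is a polynomial in \<open>x\<close> alone and vanishes at \<open>(a, - b)\<close> as soon as it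
  vanishes at \<open>(a, b)\<close>. As it has only one zero, the two points coincide.
\<close>

lemma small_pole_imp_Weierstrass:
  assumes h: "h \<in> function_field \<alpha> g - {0}" and P: "b ^ 2 = poly f a"
    and n: "0 < n" "n \<le> 2 * g"
    and infinity: "order_at \<alpha> g Infinity h = - int n"
    and zero: "order_at \<alpha> g (Affine a b) h = int n"
    and elsewhere: "\<And>c d. d ^ 2 = poly f c \<Longrightarrow> Affine c d \<noteq> Affine a b \<Longrightarrow> order_at \<alpha> g (Affine c d) h = 0"
  shows "b = 0"
proof (rule ccontr)
  assume b: "b \<noteq> 0"
  have "0 \<le> order_at \<alpha> g (Affine c d) h" if "d ^ 2 = poly f c" for c d
    using zero elsewhere[OF that] by (cases "Affine c d = Affine a b") auto
  then obtain p q where pq: "h = poly_fun p + poly_fun q * y"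
    using regular_imp_polynomial[OF h] by blast
  have "q = 0"
  proof (rule ccontr)
    assume "q \<noteq> 0"
    then obtain k where "is_order Infinity h k" "k \<le> - (2 * int g + 1)"
      using is_order_infinity_sum[of p q] unfolding pq by blast
    thus False using order_at_eq[OF infinity_mem] infinity n by force
  qed
  hence hp: "h = poly_eval const_fun x_fun p" using pq by (simp add: poly_eval_x_fun poly_fun.hom_zero)
  have "poly p a = 0"
  proof -
    interpret chart_point const_fun f x_fun y "\<alpha> 1" a b by (rule affine_point[OF P])
    have "is_order (Affine a b) h (int n)"
      using is_order_order_at[OF _ h, of "Affine a b"] zero P by (simp add: affine_point_iff)
    hence "has_order h (int n)" by (simp only: coord_funs.simps coord_values.simps)
    hence "h \<in> M" using mem_M_if_pos_order n by simp
    thus ?thesis unfolding hp poly_eval_mem_M_iff .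
  qed
  have Q: "(- b) ^ 2 = poly f a" using P by simp
  have "b \<noteq> - b"
  proof
    assume "b = - b"
    hence "2 * b = 0" by (metis add.right_inverse mult_2)
    thus False using b two_nonzero by simp
  qed
  interpret chart_point const_fun f x_fun y "\<alpha> 1" a "- b" by (rule affine_point[OF Q])
  have "is_order (Affine a (- b)) h 0"
    using is_order_order_at[OF _ h, of "Affine a (- b)"] elsewhere[OF Q] Q \<open>b \<noteq> - b\<close>
    by (simp add: affine_point_iff)
  hence "has_order h 0" by (simp only: coord_funs.simps coord_values.simps)
  hence "h \<notin> M" using has_order_zero_iff[of h 0] poly_eval_mem_R[of p] unfolding hp by blast
  thus False using \<open>poly p a = 0\<close> unfolding hp poly_eval_mem_M_iff by blast
qed

text \<open>
  Together with the double pole at infinity this says that the divisor of \<open>x - a\<close> is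
  \<open>2 ((a, 0) - \<infinity>)\<close>: Weierstrass points have order dividing \<open>2\<close>.
\<close>

lemma order_at_linear:
  assumes "poly f a = 0" "Affine c d \<in> curve_points \<alpha> g"
  shows "order_at \<alpha> g (Affine c d) (poly_fun [:- a, 1:]) = (if Affine c d = Affine a 0 then 2 else 0)"
proof -
  have cd: "d ^ 2 = poly f c" using assms(2) by (simp add: affine_point_iff)
  interpret chart_point const_fun f x_fun y "\<alpha> 1" c d by (rule affine_point[OF cd])
  have o: "is_order (Affine c d) (poly_fun [:- a, 1:]) (int (Polynomial.order c [:- a, 1:] * ramification))"
    using has_order_poly_eval[of "[:- a, 1:]"]
    unfolding coord_funs.simps coord_values.simps poly_eval_x_fun by simp
  have "int (Polynomial.order c [:- a, 1:] * ramification) = (if Affine c d = Affine a 0 then 2 else 0)"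
  proof (cases "c = a")
    case True
    hence "d = 0" using cd assms(1) by simp
    thus ?thesis using True order_power_n_n[of a 1] unfolding ramification_def by simp
  next
    case False
    thus ?thesis using order_0I[of "[:- a, 1:]" c] by simp
  qed
  with order_at_eq[OF assms(2) o] show ?thesis by simp
qed

lemma order_at_infinity_linear: "order_at \<alpha> g Infinity (poly_fun [:- a, 1:]) = - 2"
  using order_at_eq[OF infinity_mem is_order_infinity_poly_fun[of "[:- a, 1:]"]] by simp

section \<open>The jacobian\<close>

lemma order_at_one: "P \<in> curve_points \<alpha> g \<Longrightarrow> order_at \<alpha> g P 1 = 0"
  using order_at_eq is_order_one by blast

lemma order_at_mult:
  "P \<in> curve_points \<alpha> g \<Longrightarrow> h \<in> function_field \<alpha> g - {0} \<Longrightarrow> h' \<in> function_field \<alpha> g - {0} \<Longrightarrow>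
     order_at \<alpha> g P (h * h') = order_at \<alpha> g P h + order_at \<alpha> g P h'"
  by (intro order_at_eq is_order_mult is_order_order_at)

lemma order_at_inverse:
  "P \<in> curve_points \<alpha> g \<Longrightarrow> h \<in> function_field \<alpha> g - {0} \<Longrightarrow>
     order_at \<alpha> g P (inverse h) = - order_at \<alpha> g P h"
  by (intro order_at_eq is_order_inverse is_order_order_at)

end

text \<open>
  Sums over a set containing the support make the degree additive without a case analysis on
  cancellation.
\<close>

lemma divisor_degree_superset:
  assumes "finite A" "Poly_Mapping.keys D \<subseteq> A"
  shows "divisor_degree D = (\<Sum>P\<in>A. Poly_Mapping.lookup D P)"
  unfolding divisor_degree_def using assms by (intro sum.mono_neutral_left) (auto simp: in_keys_iff)

lemma divisor_degree_add: "divisor_degree (D + E) = divisor_degree D + divisor_degree E"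
  using divisor_degree_superset[of "Poly_Mapping.keys D \<union> Poly_Mapping.keys E" D]
    divisor_degree_superset[of "Poly_Mapping.keys D \<union> Poly_Mapping.keys E" E]
    divisor_degree_superset[OF _ keys_add, of D E]
  by (simp add: lookup_add sum.distrib)

lemma divisor_degree_uminus: "divisor_degree (- D) = - divisor_degree D"
  by (simp add: divisor_degree_def sum_negf)

lemma divisor_degree_zero: "divisor_degree 0 = 0"
  by (simp add: divisor_degree_def)

lemma divisor_degree_point: "divisor_degree (frag_of P) = 1"
  by (simp add: divisor_degree_def)

lemma carrier_degree_zero_divisors:
  "D \<in> carrier (degree_zero_divisors \<alpha> g) \<longleftrightarrow>
     Poly_Mapping.keys D \<subseteq> curve_points \<alpha> g \<and> divisor_degree D = 0"
  by (simp add: degree_zero_divisors_def)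

lemma mult_degree_zero_divisors: "D \<otimes>\<^bsub>degree_zero_divisors \<alpha> g\<^esub> E = D + E"
  and one_degree_zero_divisors: "\<one>\<^bsub>degree_zero_divisors \<alpha> g\<^esub> = 0"
  and pow_degree_zero_divisors: "D [^]\<^bsub>degree_zero_divisors \<alpha> g\<^esub> (n::nat) = frag_cmul (int n) D"
proof -
  interpret F: group "free_Abelian_group (curve_points \<alpha> g)" by simp
  show "D \<otimes>\<^bsub>degree_zero_divisors \<alpha> g\<^esub> E = D + E" "\<one>\<^bsub>degree_zero_divisors \<alpha> g\<^esub> = 0"
    by (simp_all add: degree_zero_divisors_def)
  show "D [^]\<^bsub>degree_zero_divisors \<alpha> g\<^esub> n = frag_cmul (int n) D"
    unfolding degree_zero_divisors_def F.nat_pow_consistent[symmetric] by simp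
qed

lemma subgroup_degree_zero_divisors:
  "subgroup (carrier (degree_zero_divisors \<alpha> g)) (free_Abelian_group (curve_points \<alpha> g))"
proof -
  interpret F: group "free_Abelian_group (curve_points \<alpha> g)" by simp
  show ?thesis
  proof (rule F.subgroupI)
    show "carrier (degree_zero_divisors \<alpha> g) \<noteq> {}"
      using carrier_degree_zero_divisors[of 0] divisor_degree_zero by auto
  next
    fix D E assume "D \<in> carrier (degree_zero_divisors \<alpha> g)" "E \<in> carrier (degree_zero_divisors \<alpha> g)"
    thus "D \<otimes>\<^bsub>free_Abelian_group (curve_points \<alpha> g)\<^esub> E \<in> carrier (degree_zero_divisors \<alpha> g)"
      using keys_add[of D E] by (auto simp: carrier_degree_zero_divisors divisor_degree_add)
  qed (auto simp: carrier_degree_zero_divisors divisor_degree_uminus)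
qed

lemma comm_group_degree_zero_divisors: "comm_group (degree_zero_divisors \<alpha> g)"
proof (rule group.group_comm_groupI)
  interpret F: group "free_Abelian_group (curve_points \<alpha> g)" by simp
  show "group (degree_zero_divisors \<alpha> g)"
    using F.subgroup_imp_group[OF subgroup_degree_zero_divisors[of \<alpha> g]]
    by (simp add: degree_zero_divisors_def)
qed (simp add: mult_degree_zero_divisors add.commute)

lemma inv_degree_zero_divisors:
  assumes "D \<in> carrier (degree_zero_divisors \<alpha> g)"
  shows "inv\<^bsub>degree_zero_divisors \<alpha> g\<^esub> D = - D"
proof -
  interpret comm_group "degree_zero_divisors \<alpha> g" by (rule comm_group_degree_zero_divisors)
  show ?thesis using assms
    by (intro inv_equality)
      (auto simp: mult_degree_zero_divisors one_degree_zero_divisors carrier_degree_zero_divisors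
        divisor_degree_uminus)
qed

context hyperelliptic_curve
begin

lemma principal_divisors_iff:
  "D \<in> principal_divisors \<alpha> g \<longleftrightarrow> D \<in> carrier (degree_zero_divisors \<alpha> g) \<and>
     (\<exists>h\<in>function_field \<alpha> g - {0}. \<forall>P\<in>curve_points \<alpha> g.
        Poly_Mapping.lookup D P = order_at \<alpha> g P h)"
  by (simp add: principal_divisors_def)

text \<open>
  The order at a point turns products and inverses of functions into sums and negatives.
\<close>

lemma normal_principal_divisors: "principal_divisors \<alpha> g \<lhd> degree_zero_divisors \<alpha> g"
proof -
  interpret comm_group "degree_zero_divisors \<alpha> g" by (rule comm_group_degree_zero_divisors)
  have "subgroup (principal_divisors \<alpha> g) (degree_zero_divisors \<alpha> g)"
  proof (rule subgroupI)
    show "principal_divisors \<alpha> g \<subseteq> carrier (degree_zero_divisors \<alpha> g)"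
      by (auto simp: principal_divisors_iff)
    have "\<exists>h\<in>function_field \<alpha> g - {0}. \<forall>P\<in>curve_points \<alpha> g.
        Poly_Mapping.lookup 0 P = order_at \<alpha> g P h"
      using one_mem_function_field by (intro bexI[of _ 1]) (simp_all add: order_at_one)
    hence "0 \<in> principal_divisors \<alpha> g"
      by (simp add: principal_divisors_iff carrier_degree_zero_divisors divisor_degree_zero)
    thus "principal_divisors \<alpha> g \<noteq> {}" by blast
  next
    fix D assume D: "D \<in> principal_divisors \<alpha> g"
    then obtain h where "h \<in> function_field \<alpha> g - {0}"
      "\<forall>P\<in>curve_points \<alpha> g. Poly_Mapping.lookup D P = order_at \<alpha> g P h"
      unfolding principal_divisors_iff by blast
    hence "\<exists>h\<in>function_field \<alpha> g - {0}. \<forall>P\<in>curve_points \<alpha> g.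
        Poly_Mapping.lookup (- D) P = order_at \<alpha> g P h"
      using inverse_mem_function_field by (intro bexI[of _ "inverse h"]) (auto simp: order_at_inverse)
    moreover have "D \<in> carrier (degree_zero_divisors \<alpha> g)" using D by (simp add: principal_divisors_iff)
    ultimately show "inv\<^bsub>degree_zero_divisors \<alpha> g\<^esub> D \<in> principal_divisors \<alpha> g"
      using inv_closed inv_degree_zero_divisors[of D] by (metis principal_divisors_iff)
  next
    fix D E assume D: "D \<in> principal_divisors \<alpha> g" and E: "E \<in> principal_divisors \<alpha> g"
    then obtain h h' where "h \<in> function_field \<alpha> g - {0}"
      "\<forall>P\<in>curve_points \<alpha> g. Poly_Mapping.lookup D P = order_at \<alpha> g P h"
      "h' \<in> function_field \<alpha> g - {0}"
      "\<forall>P\<in>curve_points \<alpha> g. Poly_Mapping.lookup E P = order_at \<alpha> g P h'"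
      unfolding principal_divisors_iff by blast
    hence "\<exists>h\<in>function_field \<alpha> g - {0}. \<forall>P\<in>curve_points \<alpha> g.
        Poly_Mapping.lookup (D + E) P = order_at \<alpha> g P h"
      using mult_mem_function_field
      by (intro bexI[of _ "h * h'"]) (auto simp: order_at_mult lookup_add)
    moreover have "D \<in> carrier (degree_zero_divisors \<alpha> g)" "E \<in> carrier (degree_zero_divisors \<alpha> g)"
      using D E by (simp_all add: principal_divisors_iff)
    ultimately show "D \<otimes>\<^bsub>degree_zero_divisors \<alpha> g\<^esub> E \<in> principal_divisors \<alpha> g"
      using m_closed mult_degree_zero_divisors by (metis principal_divisors_iff)
  qed
  thus ?thesis by (rule subgroup_imp_normal)
qed

lemma group_jacobian: "group (jacobian \<alpha> g)"
  unfolding jacobian_def by (rule normal.factorgroup_is_group[OF normal_principal_divisors])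

lemma point_divisor_mem:
  "P \<in> curve_points \<alpha> g \<Longrightarrow> frag_of P - frag_of Infinity \<in> carrier (degree_zero_divisors \<alpha> g)"
  using keys_diff[of "frag_of P" "frag_of Infinity"] infinity_mem
  by (auto simp: carrier_degree_zero_divisors divisor_degree_point divisor_degree_uminus
      divisor_degree_add[of _ "- _", simplified])

lemma embedding_mem: "P \<in> curve_points \<alpha> g \<Longrightarrow> canonical_embedding \<alpha> g P \<in> carrier (jacobian \<alpha> g)"
  using point_divisor_mem
  by (simp add: jacobian_def carrier_FactGroup canonical_embedding_def divisor_class_def)

lemma embedding_pow_eq_one_iff:
  assumes "P \<in> curve_points \<alpha> g"
  shows "canonical_embedding \<alpha> g P [^]\<^bsub>jacobian \<alpha> g\<^esub> (n::nat) = \<one>\<^bsub>jacobian \<alpha> g\<^esub> \<longleftrightarrow>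
     frag_cmul (int n) (frag_of P - frag_of Infinity) \<in> principal_divisors \<alpha> g"
proof -
  interpret normal "principal_divisors \<alpha> g" "degree_zero_divisors \<alpha> g"
    by (rule normal_principal_divisors)
  let ?D = "frag_of P - frag_of Infinity"
  have D: "?D \<in> carrier (degree_zero_divisors \<alpha> g)" by (rule point_divisor_mem[OF assms])
  have "canonical_embedding \<alpha> g P [^]\<^bsub>jacobian \<alpha> g\<^esub> n =
      principal_divisors \<alpha> g #>\<^bsub>degree_zero_divisors \<alpha> g\<^esub> frag_cmul (int n) ?D"
    unfolding canonical_embedding_def divisor_class_def jacobian_def FactGroup_pow[OF D]
      pow_degree_zero_divisors ..
  moreover have "frag_cmul (int n) ?D \<in> carrier (degree_zero_divisors \<alpha> g)"
    using nat_pow_closed[OF D, of n] unfolding pow_degree_zero_divisors .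
  ultimately show ?thesis
    using rcos_const[OF is_group] rcos_self[OF _ is_subgroup] by (auto simp: jacobian_def)
qed

end

theorem corollary2p6:
  fixes \<alpha> :: "nat \<Rightarrow> 'a::alg_closed_field" and g :: nat
  assumes "CHAR('a) \<noteq> 2"
    and "inj_on \<alpha> {1..2*g+1}"
    and "g > 1"
  shows "(\<forall>n::nat. 3 \<le> n \<and> n \<le> 2*g \<longrightarrow>
            \<not> (\<exists>p\<in>embedded_curve \<alpha> g. group.ord (jacobian \<alpha> g) p = n)) \<and>
         \<not> (\<exists>p\<in>embedded_curve \<alpha> g. group.ord (jacobian \<alpha> g) p = 3) \<and>
         \<not> (\<exists>p\<in>embedded_curve \<alpha> g. group.ord (jacobian \<alpha> g) p = 4)"
proof -
  interpret hyperelliptic_curve \<alpha> g using assms by unfold_locales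
  interpret J: group "jacobian \<alpha> g" by (rule group_jacobian)
  interpret Div: comm_group "degree_zero_divisors \<alpha> g" by (rule comm_group_degree_zero_divisors)
  have main: False if n: "3 \<le> n" "n \<le> 2 * g" and p: "p \<in> embedded_curve \<alpha> g" "J.ord p = n" for n p
  proof -
    obtain P where P: "P \<in> curve_points \<alpha> g" "p = canonical_embedding \<alpha> g P"
      using p unfolding embedded_curve_def by blast
    have pow: "n dvd m \<longleftrightarrow> frag_cmul (int m) (frag_of P - frag_of Infinity) \<in> principal_divisors \<alpha> g" for m
      using J.pow_eq_id[OF embedding_mem[OF P(1)], of m] embedding_pow_eq_one_iff[OF P(1), of m] p(2)
      unfolding P(2) by simp
    show False
    proof (cases P)
      case Infinity
      \<comment> \<open>The embedding sends \<open>\<infinity>\<close> to the neutral element, which has order \<open>1\<close>.\<close>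
      have "n dvd 1" using pow[of 0] pow[of 1] unfolding Infinity by simp
      thus False using n by simp
    next
      case (Affine a b)
      have ab: "b ^ 2 = poly f a" using P Affine by (simp add: affine_point_iff)
      have lookup: "Poly_Mapping.lookup (frag_cmul (int m) (frag_of P - frag_of Infinity)) Q =
          (if Q = Affine a b then int m else if Q = Infinity then - int m else 0)" for m Q
        by (simp add: Affine lookup_minus)
      \<comment> \<open>A function with divisor \<open>n ((a, b) - \<infinity>)\<close>.\<close>
      obtain h where h: "h \<in> function_field \<alpha> g - {0}" and
        order: "\<forall>Q\<in>curve_points \<alpha> g.
           Poly_Mapping.lookup (frag_cmul (int n) (frag_of P - frag_of Infinity)) Q = order_at \<alpha> g Q h"
        using pow[of n] unfolding principal_divisors_iff by auto
      have b: "b = 0"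
      proof (rule small_pole_imp_Weierstrass[OF h ab, of n])
        show "order_at \<alpha> g Infinity h = - int n" "order_at \<alpha> g (Affine a b) h = int n"
          using order infinity_mem P Affine unfolding lookup by force+
        show "order_at \<alpha> g (Affine c d) h = 0" if "d ^ 2 = poly f c" "Affine c d \<noteq> Affine a b" for c d
          using bspec[OF order, of "Affine c d"] that unfolding lookup affine_point_iff
          by (auto split: if_splits)
      qed (use n in auto)
      have fa: "poly f a = 0" using ab b by simp
      have "frag_cmul (int 2) (frag_of P - frag_of Infinity) \<in> carrier (degree_zero_divisors \<alpha> g)"
        using Div.nat_pow_closed[OF point_divisor_mem[OF P(1)], of 2]
        unfolding pow_degree_zero_divisors .
      moreover have "Poly_Mapping.lookup (frag_cmul (int 2) (frag_of P - frag_of Infinity)) Q =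
          order_at \<alpha> g Q (poly_fun [:- a, 1:])" if "Q \<in> curve_points \<alpha> g" for Q
        using that order_at_linear[OF fa] order_at_infinity_linear[of a] unfolding lookup b
        by (cases Q) auto
      moreover have "poly_fun [:- a, 1:] \<in> function_field \<alpha> g - {0}"
        using poly_fun_mem_function_field by (simp add: poly_fun_eq_0_iff)
      ultimately have "n dvd 2" unfolding pow principal_divisors_iff by blast
      thus False using n by (auto dest: dvd_imp_le)
    qed
  qed
  have "3 \<le> 2 * g" "4 \<le> 2 * g" using assms(3) by simp_all
  thus ?thesis using main[of 3] main[of 4] main by auto
qed

end
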